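(* Let $\mathcal{L}\in\mathbb{H}_1$ (that is, $\mathcal{L}\in\mathbb{H}_\alpha$ with $\alpha=1$), set $w_n=\int_0^{a_n}x\,\mathcal{L}(dx)$, and assume that there exists $0<\varepsilon<1/2$ such that $$\liminf_{n\to\infty}\frac{w_{\lfloor n^\varepsilon\rfloor}}{w_n}>0 .$$ Let $K$ be the $n\times n$ random reversible Markov matrix built from i.i.d. weights of law $\mathcal{L}$ and set $\kappa_n=n a_n^{-1}w_n$. Then almost surely $\mu_{\kappa_nK}\to\mu_1$ weakly as $n\to\infty$, where $\mu_1$ is the limiting spectral distribution $\mu_\alpha$ of symmetric i.i.d. heavy-tailed matrices with index $\alpha=1$.
   Context: For $\alpha>0$, $\mathbb{H}_\alpha$ is the class of probability laws $\mathcal{L}$ supported in $[0,\infty)$ whose tail is regularly varying of index $\alpha$: $G(t):=\mathcal{L}((t,\infty))=L(t)t^{-\alpha}$ for all $t>0$, with $L$ slowly varying at $\infty$ (i.e. $L(xt)/L(t)\to1$ as $t\to\infty$ for every $x>0$). Set $a_n=\inf\{a>0: nG(a)\le 1\}$. Let $(U_{i,j})_{1\le i\le j}$ be an infinite table of i.i.d. random variables of law $\mathcal{L}$, with $U_{j,i}=U_{i,j}$. For each $n$, $K=K^{(n)}$ is the $n\times n$ matrix $K_{i,j}=U_{i,j}/\rho_i$ with $\rho_i=\sum_{j=1}^nU_{i,j}$ (and $K_{i,j}=\delta_{i,j}$ for all $j$ if $\rho_i=0$). Its eigenvalues $\lambda_1\ge\dots\ge\lambda_n$ are real. For an $n\times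 n$ matrix $M$ with real spectrum, $\mu_M=\frac1n\sum_k\delta_{\lambda_k(M)}$. Weak convergence is with respect to bounded continuous functions. Definition of $\mu_\alpha$, $\alpha\in(0,2)$: let $X=(X_{i,j})_{1\le i,j\le n}$ be a real symmetric random matrix taken from an infinite table with $(X_{i,j})_{i\le j}$ i.i.d., such that the law of $|X_{i,j}|$ is in $\mathbb{H}_\alpha$ and $\lim_{t\to\infty}\mathbb{P}(X_{i,j}>t)/\mathbb{P}(|X_{i,j}|>t)$ exists. Then (known result) almost surely $\mu_{a_n^{-1}X}$ converges weakly to a symmetric probability measure $\mu_\alpha$ on $\mathbb{R}$ depending only on $\alpha$, where in this definition $a_n=\inf\{a>0: n\,\mathbb{P}(|X_{1,1}|>a)\le 1\}$. *)

theory Defs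
  imports "HOL-Probability.Probability" "Jordan_Normal_Form.Char_Poly"
begin

definition slowly_varying :: "(real \<Rightarrow> real) \<Rightarrow> bool" where
  "slowly_varying l \<longleftrightarrow> (\<forall>x>0. ((\<lambda>t. l (x * t) / l t) \<longlongrightarrow> 1) at_top)"

text \<open>The class \<open>\<H>\<^sub>\<alpha>\<close> of laws on \<open>[0, \<infinity>)\<close> with regularly varying tail.  Since \<open>x / 0 = 0\<close>,
  \<^const>\<open>slowly_varying\<close> forces \<open>l\<close> to be eventually nonzero, so the tail never vanishes.\<close>

definition heavy_tailed :: "real \<Rightarrow> real measure \<Rightarrow> bool" where
  "heavy_tailed \<alpha> L \<longleftrightarrow> 0 < \<alpha> \<and> prob_space L \<and> sets L = sets borel \<and> measure L {..<0} = 0 \<and>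
     (\<exists>l. slowly_varying l \<and> (\<forall>t>0. measure L {t<..} = l t * t powr (- \<alpha>)))"

definition tail_scale :: "real measure \<Rightarrow> nat \<Rightarrow> real" where
  "tail_scale L n = Inf {a. 0 < a \<and> real n * measure L {a<..} \<le> 1}"

definition truncated_mean :: "real measure \<Rightarrow> nat \<Rightarrow> real" where
  "truncated_mean L n = (LINT x:{0..tail_scale L n}|L. x)"

definition kappa :: "real measure \<Rightarrow> nat \<Rightarrow> real" where
  "kappa L n = real n * inverse (tail_scale L n) * truncated_mean L n"

text \<open>Infinite symmetric tables, indexed from \<open>0\<close>, whose entries on and above the diagonal are
  i.i.d. of law \<open>L\<close>.\<close>

definition iid_symmetric_table ::
    "real measure \<Rightarrow> 'a measure \<Rightarrow> (nat \<Rightarrow> nat \<Rightarrow> 'a \<Rightarrow> real) \<Rightarrow> bool" where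
  "iid_symmetric_table L M U \<longleftrightarrow> prob_space M \<and>
     prob_space.indep_vars M (\<lambda>_. borel) (\<lambda>(i, j). U i j) {(i, j). i \<le> j} \<and>
     (\<forall>i j. i \<le> j \<longrightarrow> distr M borel (U i j) = L) \<and>
     (\<forall>i j. U j i = U i j)"

definition table_mat :: "nat \<Rightarrow> (nat \<Rightarrow> nat \<Rightarrow> real) \<Rightarrow> real mat" where
  "table_mat n u = mat n n (\<lambda>(i, j). u i j)"

definition markov_mat :: "nat \<Rightarrow> (nat \<Rightarrow> nat \<Rightarrow> real) \<Rightarrow> real mat" where
  "markov_mat n u = mat n n (\<lambda>(i, j).
     let \<rho> = (\<Sum>k<n. u i k)
     in if \<rho> = 0 then (if i = j then 1 else 0) else u i j / \<rho>)"

text \<open>Real eigenvalues in decreasing order, repeated according to algebraic multiplicity.\<close>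

definition real_eigenvalues :: "real mat \<Rightarrow> real list" where
  "real_eigenvalues A = rev (sorted_list_of_multiset (proots (char_poly A)))"

text \<open>Only meaningful for matrices with real spectrum, where the list of real eigenvalues has
  length \<^term>\<open>dim_row A\<close>.\<close>

definition spectral_measure :: "real mat \<Rightarrow> real measure" where
  "spectral_measure A =
     distr (uniform_count_measure {..<dim_row A}) borel (\<lambda>k. real_eigenvalues A ! k)"

text \<open>Weak convergence tested on bounded continuous functions; the library's \<^const>\<open>weak_conv_m\<close>
  is stated through distribution functions instead.\<close>

definition weakly_converges :: "(nat \<Rightarrow> real measure) \<Rightarrow> real measure \<Rightarrow> bool" where
  "weakly_converges N \<mu> \<longleftrightarrow>
     (\<forall>f :: real \<Rightarrow> real. continuous_on UNIV f \<and> bounded (range f) \<longrightarrow>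
        (\<lambda>n. integral\<^sup>L (N n) f) \<longlonglongrightarrow> integral\<^sup>L \<mu> f)"

text \<open>\<open>\<mu>\<close> is the law \<open>\<mu>\<^sub>\<alpha>\<close>: the symmetric probability measure that is the common almost sure limiting
  spectral distribution of all symmetric matrices with i.i.d. heavy-tailed entries of index \<open>\<alpha>\<close>.
  Such a \<open>\<mu>\<close> is necessarily unique.  As almost sure convergence depends only on the law of the
  table, nothing is lost by fixing the type of the sample space to be that of the tables
  themselves.\<close>

definition heavy_tailed_spectral_limit :: "real \<Rightarrow> real measure \<Rightarrow> bool" where
  "heavy_tailed_spectral_limit \<alpha> \<mu> \<longleftrightarrow> 0 < \<alpha> \<and> \<alpha> < 2 \<and>
     prob_space \<mu> \<and> sets \<mu> = sets borel \<and> distr \<mu> borel uminus = \<mu> \<and>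
     (\<forall>(\<nu> :: real measure) (M :: (nat \<times> nat \<Rightarrow> real) measure) X.
        iid_symmetric_table \<nu> M X \<and>
        heavy_tailed \<alpha> (distr \<nu> borel abs) \<and>
        (\<exists>\<theta>. ((\<lambda>t. measure \<nu> {t<..} / measure \<nu> {x. t < \<bar>x\<bar>}) \<longlongrightarrow> \<theta>) at_top) \<longrightarrow>
        (AE \<omega> in M. weakly_converges
           (\<lambda>n. spectral_measure
              (inverse (tail_scale (distr \<nu> borel abs) n) \<cdot>\<^sub>m table_mat n (\<lambda>i j. X i j \<omega>))) \<mu>))"

end

theory Submission
  imports Defs "Jordan_Normal_Form.Schur_Decomposition" "Jordan_Normal_Form.Spectral_Radius"
begin

text \<open>Let \<open>D\<close> be the diagonal matrix of the normalized row sums \<open>\<rho>\<^sub>i / (n w\<^sub>n)\<close>.  Then \<open>\<kappa>\<^sub>n K\<close> is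
  \<open>D\<^sup>-\<^sup>1 A\<close> with \<open>A = U / a\<^sub>n\<close>, so its eigenvalues are those of the symmetric pencil \<open>(A, D)\<close>, and the
  number of them above \<open>t\<close> is the largest dimension of a subspace on which \<open>A - t D\<close> is positive.  On
  the vectors vanishing at the rows where \<open>D\<close> is not within \<open>\<eta>\<close> of the identity, \<open>t D\<close> lies between
  \<open>t - \<eta> |t|\<close> and \<open>t + \<eta> |t|\<close>; hence the eigenvalue counting functions of \<open>\<kappa>\<^sub>n K\<close> and \<open>A\<close> agree up
  to this shift of \<open>t\<close> and the number of bad rows.

  It remains to see that almost surely only \<open>o(n)\<close> rows are bad.  Since \<open>\<alpha> = 1\<close> gives
  \<open>a\<^sub>n = o(n w\<^sub>n)\<close>, truncation at a large multiple of \<open>a\<^sub>n\<close> and Chebyshev's inequality show that sums of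
  at most \<open>n\<close> weights are within \<open>\<eta> n w\<^sub>n\<close> of their centering with probability close to 1.  The part of
  a row on and above the diagonal is independent of the corresponding parts of the other rows, and
  likewise for the part below it, so Hoeffding's inequality and the Borel--Cantelli lemma apply to each
  of the two parts.\<close>

section \<open>Symmetric matrices and pencils\<close>

text \<open>Over the complex numbers an eigenvector v for some k exists. The Hermitian form of the
  matrix at v is k times the squared norm of v, and symmetry makes it equal to its own conjugate;
  hence k is real.\<close>

lemma symmetric_real_eigenvalue:
  fixes A :: "real mat"
  assumes A: "A \<in> carrier_mat n n" and sym: "transpose_mat A = A" and n: "0 < n"
  shows "\<exists>e. eigenvalue A e"
proof -
  define C where "C = map_mat complex_of_real A"
  have C: "C \<in> carrier_mat n n" using A by (simp add: C_def)
  from spectrum_non_empty[OF C n] obtain k where k: "eigenvalue C k"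
    by (auto simp: spectrum_def)
  then obtain v where v: "v \<in> carrier_vec n" "v \<noteq> 0\<^sub>v n" "C *\<^sub>v v = k \<cdot>\<^sub>v v"
    using C unfolding eigenvalue_def eigenvector_def by auto
  define f where "f i = vec_index v i" for i
  define a where "a i j = index_mat A (i, j)" for i j
  have a_sym: "a i j = a j i" if "i < n" "j < n" for i j
    using arg_cong[OF sym, of "\<lambda>B. index_mat B (i, j)"] that A by (simp add: a_def)
  have ev: "(\<Sum>j<n. of_real (a i j) * f j) = k * f i" if "i < n" for i
    using arg_cong[OF v(3), of "\<lambda>w. vec_index w i"] that A v(1)
    by (simp add: C_def mult_mat_vec_def scalar_prod_def row_def a_def f_def atLeast0LessThan)
  define S where "S = (\<Sum>i<n. cnj (f i) * (\<Sum>j<n. of_real (a i j) * f j))"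
  define N where "N = (\<Sum>i<n. (cmod (f i))\<^sup>2)"
  have "S = (\<Sum>i<n. cnj (f i) * (k * f i))"
    unfolding S_def by (intro sum.cong refl) (simp add: ev)
  also have "\<dots> = k * of_real N"
    unfolding N_def of_real_sum sum_distrib_left
    by (intro sum.cong refl, subst complex_norm_square) (simp add: algebra_simps)
  finally have S1: "S = k * of_real N" .
  have "cnj S = (\<Sum>i<n. \<Sum>j<n. f i * (of_real (a i j) * cnj (f j)))"
    by (simp add: S_def sum_distrib_left)
  also have "\<dots> = (\<Sum>j<n. \<Sum>i<n. f i * (of_real (a i j) * cnj (f j)))"
    by (rule sum.swap)
  also have "\<dots> = S"
    unfolding S_def sum_distrib_left
    by (intro sum.cong refl) (simp add: a_sym algebra_simps)
  finally have S2: "cnj S = S" .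
  obtain i where i: "i < n" "f i \<noteq> 0"
    using v(1,2) unfolding f_def by (metis eq_vecI carrier_vecD index_zero_vec)
  have "N > 0"
    unfolding N_def by (rule sum_pos2[of _ i]) (use i in auto)
  then have "cnj k = k"
    using S1 S2 by simp
  then obtain e where e: "k = of_real e"
    by (metis Reals_cnj_iff Reals_cases)
  \<comment> \<open>The eigenvector is complex, so \<open>e\<close> is carried back to the real
    matrix as a root of the characteristic polynomial.\<close>
  have "poly (char_poly C) (of_real e) = 0"
    using k e eigenvalue_root_char_poly[OF C] by simp
  then have "poly (char_poly A) e = 0"
    unfolding C_def of_real_hom.char_poly_hom[OF A] by simp
  then show ?thesis
    using eigenvalue_root_char_poly[OF A] by auto
qed

text \<open>Gram-Schmidt leaves the first vector of its input unchanged, so it is applied to a basis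
  that starts with \<open>v\<close>. Its output is orthogonal but not normalized; dividing each
  column by its length turns \<open>v\<close> into a multiple of itself.\<close>

lemma orthogonal_mat_with_first_col:
  fixes v :: "real vec"
  assumes v: "v \<in> carrier_vec n" and v0: "v \<noteq> 0\<^sub>v n"
  shows "\<exists>Q\<in>carrier_mat n n. \<exists>c. transpose_mat Q * Q = 1\<^sub>m n \<and> col Q 0 = c \<cdot>\<^sub>v v"
proof -
  interpret cof_vec_space n "TYPE(real)" .
  define b where "b = basis_completion v"
  define ws where "ws = gram_schmidt n b"
  have n: "n \<noteq> 0"
    using v v0 by auto
  from basis_completion[OF v v0, folded b_def]
  have dist_b: "distinct b" and indep: "\<not> lin_dep (set b)" and b: "set b \<subseteq> carrier_vec n"
    and hdb: "hd b = v" and len_b: "length b = n" by auto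
  from hdb len_b n obtain vs where bv: "b = v # vs" by (cases b, auto)
  from gram_schmidt_result[OF b dist_b indep refl, folded ws_def]
  have ws: "set ws \<subseteq> carrier_vec n" "corthogonal ws" "length ws = n"
    by (auto simp: len_b)
  have hdws: "hd ws = v"
    using gram_schmidt_hd[OF v, of vs, folded bv] unfolding ws_def .
  have ws0: "ws ! 0 = v"
    using hdws ws(3) n by (metis hd_conv_nth list.size(3))
  define ip where "ip i j = (\<Sum>k<n. vec_index (ws ! i) k * vec_index (ws ! j) k)" for i j
  have wsc: "ws ! i \<in> carrier_vec n" if "i < n" for i
    using ws that by auto
  have ip_eq: "ip i j = scalar_prod (ws ! i) (conjugate (ws ! j))" if "i < n" "j < n" for i j
    using wsc[OF that(1)] wsc[OF that(2)] by (simp add: ip_def scalar_prod_def atLeast0LessThan)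
  have ip0: "ip i j = 0 \<longleftrightarrow> i \<noteq> j" if "i < n" "j < n" for i j
    using corthogonalD[OF ws(2), of i j] that ws(3) ip_eq[OF that] by simp
  have ip_pos: "ip i i > 0" if "i < n" for i
    using ip0[OF that that] sum_nonneg[of "{..<n}" "\<lambda>k. vec_index (ws ! i) k * vec_index (ws ! i) k"]
    unfolding ip_def by force
  define Q where "Q = mat n n (\<lambda>(i, j). vec_index (ws ! j) i / sqrt (ip j j))"
  have Q: "Q \<in> carrier_mat n n" by (simp add: Q_def)
  have "transpose_mat Q * Q = 1\<^sub>m n"
  proof (rule eq_matI)
    fix i j assume "i < dim_row (1\<^sub>m n :: real mat)" "j < dim_col (1\<^sub>m n :: real mat)"
    then have ij: "i < n" "j < n" by auto
    then have "index_mat (transpose_mat Q * Q) (i, j) = ip i j / (sqrt (ip i i) * sqrt (ip j j))"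
      using Q by (simp add: Q_def scalar_prod_def ip_def atLeast0LessThan sum_divide_distrib)
    also have "\<dots> = index_mat (1\<^sub>m n) (i, j)"
      using ij ip0[of i j] ip_pos[of i] by (auto simp: real_sqrt_mult_self)
    finally show "index_mat (transpose_mat Q * Q) (i, j) = index_mat (1\<^sub>m n) (i, j)" .
  qed (use Q in auto)
  moreover have "col Q 0 = (1 / sqrt (ip 0 0)) \<cdot>\<^sub>v v"
    using n v ws0 by (intro eq_vecI) (auto simp: Q_def)
  ultimately show ?thesis using Q by blast
qed

text \<open>Deflation: in an orthogonal basis that starts with an eigenvector, a symmetric matrix
  splits into a 1 by 1 block and a smaller symmetric block, to which the induction hypothesis
  applies.\<close>

lemma symmetric_mat_diagonalization:
  fixes A :: "real mat"
  assumes "A \<in> carrier_mat n n" "transpose_mat A = A"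
  shows "\<exists>Q\<in>carrier_mat n n. \<exists>l. transpose_mat Q * Q = 1\<^sub>m n \<and> transpose_mat Q * A * Q = mat_diag n l"
  using assms
proof (induction n arbitrary: A)
  case 0
  then show ?case
    by (intro bexI[of _ "1\<^sub>m 0"] exI[of _ "\<lambda>_. 0"]) (auto intro!: eq_matI simp: mat_diag_def)
next
  case (Suc m A)
  let ?n = "Suc m"
  note A = Suc.prems(1)
  obtain e where "eigenvalue A e"
    using symmetric_real_eigenvalue[OF Suc.prems] by auto
  then obtain v where v: "v \<in> carrier_vec ?n" "v \<noteq> 0\<^sub>v ?n" "A *\<^sub>v v = e \<cdot>\<^sub>v v"
    using A unfolding eigenvalue_def eigenvector_def by auto
  obtain Q c where Q: "Q \<in> carrier_mat ?n ?n" and QQ: "transpose_mat Q * Q = 1\<^sub>m ?n"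
    and Q0: "col Q 0 = c \<cdot>\<^sub>v v"
    using orthogonal_mat_with_first_col[OF v(1,2)] by auto
  have Qt: "transpose_mat Q \<in> carrier_mat ?n ?n" using Q by simp
  define B where "B = transpose_mat Q * A * Q"
  have B: "B \<in> carrier_mat ?n ?n" using A Q by (simp add: B_def)
  have Bsym: "transpose_mat B = B"
  proof -
    have "transpose_mat B = transpose_mat Q * (transpose_mat A * Q)"
      unfolding B_def using transpose_mult[of "transpose_mat Q * A" ?n ?n Q ?n]
        transpose_mult[of "transpose_mat Q" ?n ?n A ?n] A Q by simp
    then show ?thesis
      unfolding B_def Suc.prems(2) using A Q Qt by simp
  qed
  have AQ0: "col (A * Q) 0 = e \<cdot>\<^sub>v col Q 0"
  proof -
    have "col (A * Q) 0 = A *\<^sub>v col Q 0"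
      using A Q by (intro col_mult2) auto
    also have "\<dots> = c \<cdot>\<^sub>v (A *\<^sub>v v)"
      unfolding Q0 using A v(1) by (rule mult_mat_vec)
    also have "\<dots> = e \<cdot>\<^sub>v col Q 0"
      unfolding v(3) Q0 by (simp add: smult_smult_assoc mult.commute)
    finally show ?thesis .
  qed
  \<comment> \<open>The first column of \<open>Q\<close> is an eigenvector and \<open>Q\<close> is
    orthogonal, so the first column of \<open>B\<close> is \<open>e\<close> times the first unit
    vector. Symmetry then clears the first row as well.\<close>
  have B0: "index_mat B (i, 0) = (if i = 0 then e else 0)" if i: "i < ?n" for i
  proof -
    have "index_mat B (i, 0) = index_mat (transpose_mat Q * (A * Q)) (i, 0)"
      unfolding B_def using A Q Qt by simp
    also have "\<dots> = scalar_prod (row (transpose_mat Q) i) (e \<cdot>\<^sub>v col Q 0)"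
      using A Q i AQ0 by simp
    also have "\<dots> = e * index_mat (transpose_mat Q * Q) (i, 0)"
      using Q i by (simp add: scalar_prod_smult_distrib[of _ ?n])
    also have "\<dots> = (if i = 0 then e else 0)"
      unfolding QQ using i by simp
    finally show ?thesis .
  qed
  have B0': "index_mat B (0, i) = (if i = 0 then e else 0)" if i: "i < ?n" for i
    using B0[OF i] B i arg_cong[OF Bsym, of "\<lambda>B. index_mat B (0, i)"] by simp
  define A3 where "A3 = mat m m (\<lambda>(i, j). index_mat B (Suc i, Suc j))"
  have A3: "A3 \<in> carrier_mat m m" by (simp add: A3_def)
  have A3sym: "transpose_mat A3 = A3"
  proof (rule eq_matI)
    fix i j assume "i < dim_row A3" "j < dim_col A3"
    then show "index_mat (transpose_mat A3) (i, j) = index_mat A3 (i, j)"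
      using B arg_cong[OF Bsym, of "\<lambda>B. index_mat B (Suc i, Suc j)"] by (simp add: A3_def)
  qed (simp_all add: A3_def)
  define E where "E = mat 1 1 (\<lambda>_. e)"
  have E: "E \<in> carrier_mat 1 1" by (simp add: E_def)
  have B_block: "B = four_block_mat E (0\<^sub>m 1 m) (0\<^sub>m m 1) A3"
    by (rule eq_matI) (use B B0 B0' in \<open>auto simp: E_def A3_def less_Suc_eq_0_disj\<close>)
  obtain R l where R: "R \<in> carrier_mat m m" and RR: "transpose_mat R * R = 1\<^sub>m m"
    and Rl: "transpose_mat R * A3 * R = mat_diag m l"
    using Suc.IH[OF A3 A3sym] by auto
  define R' where "R' = four_block_mat (1\<^sub>m 1) (0\<^sub>m 1 m) (0\<^sub>m m 1) R"
  have R': "R' \<in> carrier_mat ?n ?n"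
    using R unfolding R'_def by (metis four_block_carrier_mat one_carrier_mat plus_1_eq_Suc)
  have R't: "transpose_mat R' = four_block_mat (1\<^sub>m 1) (0\<^sub>m 1 m) (0\<^sub>m m 1) (transpose_mat R)"
    unfolding R'_def by (subst transpose_four_block_mat[of _ 1 1 _ m _ m]) (use R in auto)
  have Rt: "transpose_mat R \<in> carrier_mat m m" using R by simp
  have RR': "transpose_mat R' * R' = 1\<^sub>m ?n"
  proof -
    have "transpose_mat R' * R' = four_block_mat (1\<^sub>m 1) (0\<^sub>m 1 m) (0\<^sub>m m 1) (1\<^sub>m m)"
      unfolding R't unfolding R'_def
      by (subst mult_four_block_mat[of _ 1 1 _ m _ m]) (use R RR in auto)
    then show ?thesis
      by (auto intro!: eq_matI)
  qed
  have Rl': "transpose_mat R' * B * R' = mat_diag ?n (\<lambda>i. case i of 0 \<Rightarrow> e | Suc k \<Rightarrow> l k)"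
  proof -
    have "transpose_mat R' * B = four_block_mat E (0\<^sub>m 1 m) (0\<^sub>m m 1) (transpose_mat R * A3)"
      unfolding R't B_block
      by (subst mult_four_block_mat[of _ 1 1 _ m _ m]) (use R E A3 in auto)
    also have "\<dots> * R' = four_block_mat E (0\<^sub>m 1 m) (0\<^sub>m m 1) (transpose_mat R * A3 * R)"
      unfolding R'_def
      by (subst mult_four_block_mat[of _ 1 1 _ m _ m]) (use R E A3 in auto)
    also have "\<dots> = mat_diag ?n (\<lambda>i. case i of 0 \<Rightarrow> e | Suc k \<Rightarrow> l k)"
      unfolding Rl by (auto intro!: eq_matI simp: E_def mat_diag_def split: nat.split)
    finally show ?thesis .
  qed
  define P where "P = Q * R'"
  have P: "P \<in> carrier_mat ?n ?n" using Q R' by (simp add: P_def)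
  have Pt: "transpose_mat P = transpose_mat R' * transpose_mat Q"
    unfolding P_def using Q R' by (rule transpose_mult)
  have R't': "transpose_mat R' \<in> carrier_mat ?n ?n" using R' by simp
  have "transpose_mat P * P = transpose_mat R' * (transpose_mat Q * Q) * R'"
    unfolding Pt unfolding P_def using Q R' Qt R't'
    by (smt (verit, best) assoc_mult_mat mult_carrier_mat)
  then have "transpose_mat P * P = 1\<^sub>m ?n"
    unfolding QQ using R't' R' RR' by simp
  moreover have "transpose_mat P * A * P = transpose_mat R' * B * R'"
    unfolding Pt B_def unfolding P_def using Q R' Qt R't' A
    by (smt (verit, best) assoc_mult_mat mult_carrier_mat)
  ultimately show ?case
    using P Rl' by metis
qed

section \<open>Simultaneous diagonalization of a symmetric pencil\<close>

lemma mat_diag_carrier: "mat_diag n f \<in> carrier_mat n n"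
  by (simp add: mat_diag_def)

text \<open>With D the diagonal matrix of \<open>d\<close>, the matrix D^(-1) A is similar to the
  symmetric matrix S = D^(-1/2) A D^(-1/2). If Q diagonalizes S orthogonally, then P = D^(-1/2) Q
  normalizes D, diagonalizes A as a form, and conjugates D^(-1) A to the same diagonal
  matrix.\<close>

lemma symmetric_pencil_diagonalization:
  fixes A :: "real mat"
  assumes A: "A \<in> carrier_mat n n" and sym: "transpose_mat A = A" and d: "\<And>i. i < n \<Longrightarrow> 0 < d i"
  shows "\<exists>P\<in>carrier_mat n n. \<exists>l. transpose_mat P * mat_diag n d * P = 1\<^sub>m n
    \<and> transpose_mat P * A * P = mat_diag n l
    \<and> char_poly (mat n n (\<lambda>(i, j). index_mat A (i, j) / d i)) = (\<Prod>k<n. [:- l k, 1:])"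
proof -
  define E where "E = mat_diag n (\<lambda>i. 1 / sqrt (d i))"
  define F where "F = mat_diag n (\<lambda>i. sqrt (d i))"
  define D where "D = mat_diag n d"
  note carr = mat_diag_carrier
  have d': "d i \<noteq> 0" "\<bar>d i\<bar> = d i" "sqrt (d i) * sqrt (d i) = d i" if "i < n" for i
    using d[OF that] by auto
  have E: "E \<in> carrier_mat n n" and F: "F \<in> carrier_mat n n" and D: "D \<in> carrier_mat n n"
    by (simp_all add: E_def F_def D_def carr)
  have Et: "transpose_mat E = E"
    by (rule eq_matI) (auto simp: E_def mat_diag_def)
  have EDE: "E * D * E = 1\<^sub>m n"
    unfolding E_def D_def mat_diag_diag
    by (intro eq_matI) (auto simp: mat_diag_def d' field_simps)
  have EF: "E * F = 1\<^sub>m n"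
    unfolding E_def F_def mat_diag_diag
    by (intro eq_matI) (auto simp: mat_diag_def d')
  have FE: "F * E = 1\<^sub>m n"
    using mat_mult_left_right_inverse[OF E F EF] .
  define S where "S = E * A * E"
  have S: "S \<in> carrier_mat n n" using E A by (simp add: S_def)
  have St: "transpose_mat S = S"
  proof -
    have "transpose_mat S = E * (A * E)"
      unfolding S_def using E A Et sym
      by (metis mult_carrier_mat transpose_mult)
    then show ?thesis
      unfolding S_def using E A by simp
  qed
  obtain Q l where Q: "Q \<in> carrier_mat n n" and QQ: "transpose_mat Q * Q = 1\<^sub>m n"
    and Ql: "transpose_mat Q * S * Q = mat_diag n l"
    using symmetric_mat_diagonalization[OF S St] by auto
  have Qt: "transpose_mat Q \<in> carrier_mat n n" using Q by simp
  have QQ': "Q * transpose_mat Q = 1\<^sub>m n"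
    using mat_mult_left_right_inverse[OF Qt Q QQ] .
  define P where "P = E * Q"
  have P: "P \<in> carrier_mat n n" using E Q by (simp add: P_def)
  have Pt: "transpose_mat P = transpose_mat Q * E"
    unfolding P_def using transpose_mult[OF E Q] Et by simp
  have conj: "transpose_mat P * B * P = transpose_mat Q * (E * B * E) * Q"
    if "B \<in> carrier_mat n n" for B
    unfolding Pt unfolding P_def using E Q Qt that
    by (smt (verit, best) assoc_mult_mat mult_carrier_mat)
  have PDP: "transpose_mat P * D * P = 1\<^sub>m n"
    unfolding conj[OF D] EDE using Q Qt QQ by simp
  have PAP: "transpose_mat P * A * P = mat_diag n l"
    unfolding conj[OF A] using Ql by (simp add: S_def)
  \<comment> \<open>\<open>R\<close> is the inverse of \<open>P\<close>, and \<open>B\<close> below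
    is D^(-1) A; the aim is B = P diag(l) R.\<close>
  define R where "R = transpose_mat Q * F"
  have R: "R \<in> carrier_mat n n" using Qt F by (simp add: R_def)
  define B where "B = mat n n (\<lambda>(i, j). index_mat A (i, j) / d i)"
  have B: "B \<in> carrier_mat n n" by (simp add: B_def)
  have EEA: "B = E * (E * A)"
    unfolding E_def mat_diag_mult_left[OF A] using A
    by (subst mat_diag_mult_left[of _ n n])
       (auto intro!: eq_matI simp: B_def d' field_simps)
  have "P * R = E * (Q * transpose_mat Q) * F"
    unfolding P_def R_def using E Q Qt F
    by (smt (verit, best) assoc_mult_mat mult_carrier_mat)
  then have PR: "P * R = 1\<^sub>m n"
    unfolding QQ' using E EF by simp
  have RP: "R * P = 1\<^sub>m n"
    using mat_mult_left_right_inverse[OF P R PR] .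
  have "P * mat_diag n l * R = E * ((Q * transpose_mat Q) * (S * ((Q * transpose_mat Q) * F)))"
    unfolding P_def R_def Ql[symmetric] using E Q Qt F S
    by (smt (verit, best) assoc_mult_mat mult_carrier_mat)
  also have "\<dots> = E * (S * F)"
    unfolding QQ' using E S F by simp
  also have "\<dots> = E * ((E * A) * (E * F))"
    unfolding S_def using E A F
    by (smt (verit, best) assoc_mult_mat mult_carrier_mat)
  also have "\<dots> = B"
    unfolding EF EEA using E A by simp
  finally have "similar_mat_wit B (mat_diag n l) P R"
    using PR RP B P R carr by (intro similar_mat_witI[of _ _ n]) auto
  then have "char_poly B = char_poly (mat_diag n l)"
    unfolding similar_mat_def by (metis char_poly_similar similar_mat_def)
  also have "\<dots> = (\<Prod>a\<leftarrow>diag_mat (mat_diag n l). [:- a, 1:])"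
    by (rule char_poly_upper_triangular[OF carr]) (auto simp: mat_diag_def)
  also have "\<dots> = (\<Prod>k<n. [:- l k, 1:])"
    by (simp add: diag_mat_def mat_diag_def atLeast0LessThan
        flip: prod.distinct_set_conv_list)
  finally show ?thesis
    using P PDP PAP unfolding B_def D_def by blast
qed

section \<open>Comparison of eigenvalue counts of two pencils\<close>

text \<open>Padding the equations with zero rows gives a square matrix that is singular because its
  last row vanishes.\<close>

lemma homogeneous_system_nontrivial_solution:
  fixes rs :: "'a :: idom vec list"
  assumes rs: "set rs \<subseteq> carrier_vec n" and len: "length rs < n"
  shows "\<exists>x\<in>carrier_vec n. x \<noteq> 0\<^sub>v n \<and> (\<forall>r\<in>set rs. scalar_prod r x = 0)"
proof -
  define ts where "ts = rs @ replicate (n - length rs) (0\<^sub>v n)"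
  define M where "M = mat_of_rows n ts"
  have lts: "length ts = n" using len by (simp add: ts_def)
  have ts: "set ts \<subseteq> carrier_vec n" using rs by (auto simp: ts_def)
  have M: "M \<in> carrier_mat n n" using lts by (auto simp: M_def)
  have row_M: "row M i = ts ! i" if "i < n" for i
    using that lts ts unfolding M_def by (metis mat_of_rows_row nth_mem subsetD)
  have last: "ts ! (n - 1) = 0\<^sub>v n"
    using len by (auto simp: ts_def nth_append)
  \<comment> \<open>A zero row of \<open>M\<close> is a unit vector in the kernel of the transpose,
    which has the same determinant.\<close>
  have "transpose_mat M *\<^sub>v unit_vec n (n - 1) = row M (n - 1)"
    using M len by (intro eq_vecI) auto
  then have "transpose_mat M *\<^sub>v unit_vec n (n - 1) = 0\<^sub>v n"
    using row_M[of "n - 1"] last len by simp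
  moreover have "unit_vec n (n - 1) \<noteq> (0\<^sub>v n :: 'a vec)"
    using len arg_cong[of "unit_vec n (n - 1)" "0\<^sub>v n :: 'a vec" "\<lambda>v. vec_index v (n - 1)"] by auto
  ultimately have "det (transpose_mat M) = 0"
    using M det_0_iff_vec_prod_zero[of "transpose_mat M" n] unit_vec_carrier[of n "n - 1"]
    by (metis transpose_carrier_mat)
  then have "det M = 0"
    using det_transpose[OF M] by simp
  then obtain x where x: "x \<in> carrier_vec n" "x \<noteq> 0\<^sub>v n" "M *\<^sub>v x = 0\<^sub>v n"
    using det_0_iff_vec_prod_zero[OF M] by auto
  have "scalar_prod r x = 0" if "r \<in> set rs" for r
  proof -
    obtain i where i: "i < length rs" "r = rs ! i"
      using \<open>r \<in> set rs\<close> by (metis in_set_conv_nth)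
    then have "r = row M i" "i < n"
      using row_M[of i] len by (auto simp: ts_def nth_append)
    then show ?thesis
      using arg_cong[OF x(3), of "\<lambda>v. vec_index v i"] M by simp
  qed
  then show ?thesis using x by blast
qed

lemma scalar_prod_congruence:
  fixes A :: "'a :: comm_semiring_0 mat"
  assumes "A \<in> carrier_mat n n" "P \<in> carrier_mat n n" "c \<in> carrier_vec n"
  shows "scalar_prod (P *\<^sub>v c) (A *\<^sub>v (P *\<^sub>v c)) = scalar_prod c ((transpose_mat P * A * P) *\<^sub>v c)"
proof -
  have "(transpose_mat P * A * P) *\<^sub>v c = transpose_mat P *\<^sub>v (A *\<^sub>v (P *\<^sub>v c))"
    using assms by (simp add: assoc_mult_mat_vec[of _ n n _ n])
  then show ?thesis
    using transpose_vec_mult_scalar[OF assms(2,3), of "A *\<^sub>v (P *\<^sub>v c)"] assms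
    by (metis comm_scalar_prod mult_mat_vec_carrier transpose_carrier_mat)
qed

lemma scalar_prod_mat_diag:
  fixes c :: "'a :: comm_ring_1 vec"
  assumes "c \<in> carrier_vec n"
  shows "scalar_prod c (mat_diag n l *\<^sub>v c) = (\<Sum>k<n. l k * (vec_index c k)\<^sup>2)"
proof -
  have "vec_index (mat_diag n l *\<^sub>v c) k = l k * vec_index c k" if "k < n" for k
    using assms that
    by (simp add: mat_diag_def scalar_prod_def if_distrib[of "\<lambda>x. x * _"] sum.delta cong: if_cong)
  then show ?thesis
    using assms by (simp add: scalar_prod_def[of c] mat_diag_def[of n l] atLeast0LessThan power2_eq_square algebra_simps)
qed

text \<open>Courant--Fischer by counting equations: if the conclusion fails, some nonzero combination of the
  eigenvectors above \<open>t\<close> vanishes on \<open>bad\<close> and has no component along the eigenvectors of the second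
  pencil above \<open>t'\<close>.\<close>

lemma pencil_count_le:
  fixes A A' P P' :: "real mat"
  assumes A: "A \<in> carrier_mat n n" and P: "P \<in> carrier_mat n n"
    and PD: "transpose_mat P * mat_diag n d * P = 1\<^sub>m n"
    and PA: "transpose_mat P * A * P = mat_diag n l"
    and A': "A' \<in> carrier_mat n n" and P': "P' \<in> carrier_mat n n"
    and PD': "transpose_mat P' * mat_diag n d' * P' = 1\<^sub>m n"
    and PA': "transpose_mat P' * A' * P' = mat_diag n l'"
    and bad: "bad \<subseteq> {..<n}"
    and le: "\<And>x. x \<in> carrier_vec n \<Longrightarrow> (\<And>i. i \<in> bad \<Longrightarrow> vec_index x i = 0) \<Longrightarrow>
      scalar_prod x (A *\<^sub>v x) - t * scalar_prod x (mat_diag n d *\<^sub>v x)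
        \<le> scalar_prod x (A' *\<^sub>v x) - t' * scalar_prod x (mat_diag n d' *\<^sub>v x)"
  shows "card {k. k < n \<and> t < l k} \<le> card {k. k < n \<and> t' < l' k} + card bad"
proof (rule ccontr)
  assume *: "\<not> ?thesis"
  define J where "J = {k. k < n \<and> t < l k}"
  define J' where "J' = {k. k < n \<and> t' < l' k}"
  define D where "D = mat_diag n d"
  define D' where "D' = mat_diag n d'"
  have D: "D \<in> carrier_mat n n" and D': "D' \<in> carrier_mat n n"
    by (simp_all add: D_def D'_def mat_diag_carrier)
  \<comment> \<open>By \<open>PD'\<close> this is the inverse of \<open>P'\<close>, so that
    \<open>c'\<close> below holds the coordinates of \<open>x\<close> in the eigenbasis of the
    second pencil.\<close>
  define H where "H = transpose_mat P' * D'"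
  have H: "H \<in> carrier_mat n n" using P' D' by (simp add: H_def)
  have finb: "finite bad" using bad finite_subset by blast
  \<comment> \<open>Three groups of equations on the coordinates \<open>c\<close>: support in
    \<open>J\<close>, no component along the eigenvectors indexed by \<open>J'\<close>, and
    vanishing on \<open>bad\<close>. Their number n - |J| + |J'| + |bad| is below n by the negated
    claim.\<close>
  define rs where "rs = map (unit_vec n) (sorted_list_of_set ({..<n} - J))
    @ map (row (H * P)) (sorted_list_of_set J') @ map (row P) (sorted_list_of_set bad)"
  have "J \<subseteq> {..<n}" by (auto simp: J_def)
  then have "card ({..<n} - J) = n - card J" "card J \<le> n"
    using card_Diff_subset[of J "{..<n}"] card_mono[of "{..<n}" J] by (auto simp: finite_subset)
  then have len: "length rs < n"
    using * unfolding J_def[symmetric] J'_def[symmetric] by (simp add: rs_def)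
  have "set rs \<subseteq> carrier_vec n"
    using H P by (auto simp: rs_def intro!: carrier_vecI)
  from homogeneous_system_nontrivial_solution[OF this len]
  obtain c where c: "c \<in> carrier_vec n" "c \<noteq> 0\<^sub>v n" and orth: "\<And>r. r \<in> set rs \<Longrightarrow> scalar_prod r c = 0"
    by blast
  have cJ: "vec_index c k = 0" if "k < n" "k \<notin> J" for k
  proof -
    have "scalar_prod (unit_vec n k) c = 0"
      using that by (intro orth) (auto simp: rs_def)
    then show ?thesis using that c by simp
  qed
  have finJ': "finite J'" by (simp add: J'_def)
  define x where "x = P *\<^sub>v c"
  have x: "x \<in> carrier_vec n" using P c by (simp add: x_def)
  define c' where "c' = H *\<^sub>v x"
  have c': "c' \<in> carrier_vec n" using H x by (simp add: c'_def)
  have c'_eq: "c' = (H * P) *\<^sub>v c"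
    unfolding c'_def x_def using H P c by simp
  have c'J: "vec_index c' k = 0" if "k \<in> J'" for k
  proof -
    have "scalar_prod (row (H * P) k) c = 0"
      using that finJ' by (intro orth) (auto simp: rs_def)
    moreover have "vec_index c' k = scalar_prod (row (H * P) k) c"
      using that H P unfolding c'_eq J'_def by (intro index_mult_mat_vec) auto
    ultimately show ?thesis by simp
  qed
  have xb: "vec_index x i = 0" if "i \<in> bad" for i
  proof -
    have "scalar_prod (row P i) c = 0"
      using that finb by (intro orth) (auto simp: rs_def)
    then show ?thesis using that bad P c by (auto simp: x_def)
  qed
  have "P' * H = 1\<^sub>m n"
    using mat_mult_left_right_inverse[OF H P'] PD' by (simp add: H_def D'_def)
  then have x_eq: "x = P' *\<^sub>v c'"
    unfolding c'_def using P' H x by (metis assoc_mult_mat_vec one_mult_mat_vec)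
  have q1: "scalar_prod x (A *\<^sub>v x) = (\<Sum>k<n. l k * (vec_index c k)\<^sup>2)"
    unfolding x_def scalar_prod_congruence[OF A P c(1)] PA by (rule scalar_prod_mat_diag[OF c(1)])
  have one: "1\<^sub>m n = mat_diag n (\<lambda>_. 1 :: real)"
    by (auto intro!: eq_matI simp: mat_diag_def)
  have q2: "scalar_prod x (mat_diag n d *\<^sub>v x) = (\<Sum>k<n. 1 * (vec_index c k)\<^sup>2)"
    unfolding x_def scalar_prod_congruence[OF mat_diag_carrier P c(1)] PD one
    by (rule scalar_prod_mat_diag[OF c(1)])
  have q3: "scalar_prod x (A' *\<^sub>v x) = (\<Sum>k<n. l' k * (vec_index c' k)\<^sup>2)"
    unfolding x_eq scalar_prod_congruence[OF A' P' c'] PA' by (rule scalar_prod_mat_diag[OF c'])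
  have q4: "scalar_prod x (mat_diag n d' *\<^sub>v x) = (\<Sum>k<n. 1 * (vec_index c' k)\<^sup>2)"
    unfolding x_eq scalar_prod_congruence[OF mat_diag_carrier P' c'] PD' one
    by (rule scalar_prod_mat_diag[OF c'])
  obtain k where k: "k < n" "vec_index c k \<noteq> 0"
    using c by (metis eq_vecI carrier_vecD index_zero_vec)
  \<comment> \<open>At this \<open>x\<close> the first form is positive, since \<open>c\<close> is
    nonzero and lives on \<open>J\<close>, whereas the second is nonpositive, since
    \<open>c'\<close> avoids \<open>J'\<close>. This contradicts \<open>le\<close>.\<close>
  have "0 < (\<Sum>k<n. (l k - t) * (vec_index c k)\<^sup>2)"
  proof (rule sum_pos2[of _ k])
    show "0 < (l k - t) * (vec_index c k)\<^sup>2"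
      using k cJ[of k] unfolding J_def by (metis (no_types, lifting) diff_gt_0_iff_gt mem_Collect_eq mult_pos_pos zero_less_power2)
    show "0 \<le> (l i - t) * (vec_index c i)\<^sup>2" if "i \<in> {..<n}" for i
      using that cJ[of i] by (cases "i \<in> J") (auto simp: J_def)
  qed (use k in auto)
  moreover have "(\<Sum>k<n. (l' k - t') * (vec_index c' k)\<^sup>2) \<le> 0"
  proof (rule sum_nonpos)
    show "(l' i - t') * (vec_index c' i)\<^sup>2 \<le> 0" if "i \<in> {..<n}" for i
      using that c'J[of i] by (cases "i \<in> J'") (auto simp: J'_def mult_nonpos_nonneg)
  qed
  ultimately show False
    using le[OF x xb] unfolding q1 q2 q3 q4
    by (simp add: left_diff_distrib sum_subtractf sum_distrib_left)
qed

section \<open>Spectral measures as normalized eigenvalue counts\<close>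

lemma real_eigenvalues_prod:
  fixes l :: "nat \<Rightarrow> real"
  assumes "char_poly A = (\<Prod>k<n. [:- l k, 1:])"
  shows "mset (real_eigenvalues A) = image_mset l (mset_set {..<n})"
proof -
  have "proots (\<Prod>k<m. [:- l k, 1:]) = image_mset l (mset_set {..<m})" for m
  proof (induction m)
    case (Suc m)
    have nz: "(\<Prod>k<m. [:- l k, 1:]) \<noteq> 0" by simp
    have "proots (\<Prod>k<Suc m. [:- l k, 1:]) = proots (\<Prod>k<m. [:- l k, 1:]) + proots [:- l m, 1:]"
      using nz by (simp add: proots_mult mult.commute del: mult_pCons_left mult_pCons_right)
    then show ?case
      using Suc by (simp add: lessThan_Suc)
  qed simp
  then show ?thesis
    by (simp add: real_eigenvalues_def assms)
qed

lemma borel_measurable_uniform_count_measure: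
  "f \<in> borel_measurable (uniform_count_measure A)"
  by (auto simp: measurable_def sets_uniform_count_measure space_uniform_count_measure)

lemma real_distribution_spectral_measure:
  assumes "0 < dim_row A"
  shows "real_distribution (spectral_measure A)"
proof -
  interpret U: prob_space "uniform_count_measure {..<dim_row A}"
    using assms by (intro prob_space_uniform_count_measure) auto
  show ?thesis
    unfolding spectral_measure_def
    by (intro U.real_distribution_distr borel_measurable_uniform_count_measure)
qed

text \<open>The order of the eigenvalue list is irrelevant: the measure of a set only counts list
  members, and these are determined by the multiset of roots.\<close>

lemma measure_spectral_measure:
  assumes A: "A \<in> carrier_mat n n" and cp: "char_poly A = (\<Prod>k<n. [:- l k, 1:])"
    and S: "S \<in> sets borel"
  shows "measure (spectral_measure A) S = card {k. k < n \<and> l k \<in> S} / n"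
proof -
  have dim: "dim_row A = n" using A by simp
  have len: "length (real_eigenvalues A) = n"
    using arg_cong[OF real_eigenvalues_prod[OF cp], of size] by simp
  have "card {k. k < n \<and> real_eigenvalues A ! k \<in> S} = length (filter (\<lambda>x. x \<in> S) (real_eigenvalues A))"
    by (simp add: length_filter_conv_card len)
  also have "\<dots> = size (filter_mset (\<lambda>x. x \<in> S) (image_mset l (mset_set {..<n})))"
    using real_eigenvalues_prod[OF cp] by (metis mset_filter size_mset)
  also have "\<dots> = card {k. k < n \<and> l k \<in> S}"
    by (simp add: filter_mset_image_mset Int_def flip: size_mset_set)
  finally have "card {k. k < n \<and> real_eigenvalues A ! k \<in> S} = card {k. k < n \<and> l k \<in> S}" .
  moreover have "measure (spectral_measure A) S = card {k. k < n \<and> real_eigenvalues A ! k \<in> S} / n"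
    unfolding spectral_measure_def dim measure_distr[OF borel_measurable_uniform_count_measure S]
    by (subst measure_uniform_count_measure)
       (auto simp: space_uniform_count_measure intro!: arg_cong[of _ _ card])
  ultimately show ?thesis by simp
qed

text \<open>On vectors vanishing on \<open>bad\<close> the forms of \<open>A\<close> and
  \<open>A'\<close> coincide, and only the diagonal parts have to be compared. Stating that
  comparison as \<open>t' * d' i \<le> t * d i\<close> treats both signs of \<open>t\<close> at
  once.\<close>

lemma spectral_measure_pencil_tail_le:
  fixes A A' :: "real mat"
  assumes n: "0 < n"
    and A: "A \<in> carrier_mat n n" "transpose_mat A = A" "\<And>i. i < n \<Longrightarrow> 0 < d i"
    and A': "A' \<in> carrier_mat n n" "transpose_mat A' = A'" "\<And>i. i < n \<Longrightarrow> 0 < d' i"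
    and bad: "bad \<subseteq> {..<n}"
    and eq: "\<And>i j. i < n \<Longrightarrow> j < n \<Longrightarrow> i \<notin> bad \<Longrightarrow> j \<notin> bad \<Longrightarrow> index_mat A (i, j) = index_mat A' (i, j)"
    and le: "\<And>i. i < n \<Longrightarrow> i \<notin> bad \<Longrightarrow> t' * d' i \<le> t * d i"
  shows "measure (spectral_measure (mat n n (\<lambda>(i, j). index_mat A (i, j) / d i))) {t<..}
    \<le> measure (spectral_measure (mat n n (\<lambda>(i, j). index_mat A' (i, j) / d' i))) {t'<..} + card bad / n"
proof -
  obtain P l where P: "P \<in> carrier_mat n n" "transpose_mat P * mat_diag n d * P = 1\<^sub>m n"
    "transpose_mat P * A * P = mat_diag n l"
    "char_poly (mat n n (\<lambda>(i, j). index_mat A (i, j) / d i)) = (\<Prod>k<n. [:- l k, 1:])"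
    using symmetric_pencil_diagonalization[of A n d] A by auto
  obtain P' l' where P': "P' \<in> carrier_mat n n" "transpose_mat P' * mat_diag n d' * P' = 1\<^sub>m n"
    "transpose_mat P' * A' * P' = mat_diag n l'"
    "char_poly (mat n n (\<lambda>(i, j). index_mat A' (i, j) / d' i)) = (\<Prod>k<n. [:- l' k, 1:])"
    using symmetric_pencil_diagonalization[of A' n d'] A' by auto
  have "card {k. k < n \<and> t < l k} \<le> card {k. k < n \<and> t' < l' k} + card bad"
  proof (rule pencil_count_le[OF A(1) P(1-3) A'(1) P'(1-3) bad])
    fix x :: "real vec" assume x: "x \<in> carrier_vec n" and xb: "\<And>i. i \<in> bad \<Longrightarrow> vec_index x i = 0"
    have quad: "scalar_prod x (B *\<^sub>v x) = (\<Sum>i<n. \<Sum>j<n. vec_index x i * (index_mat B (i, j) * vec_index x j))"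
      if "B \<in> carrier_mat n n" for B
      using that x by (simp add: scalar_prod_def atLeast0LessThan sum_distrib_left)
    have "scalar_prod x (A *\<^sub>v x) = scalar_prod x (A' *\<^sub>v x)"
      unfolding quad[OF A(1)] quad[OF A'(1)]
    proof (intro sum.cong refl)
      fix i j assume "i \<in> {..<n}" "j \<in> {..<n}"
      then show "vec_index x i * (index_mat A (i, j) * vec_index x j)
          = vec_index x i * (index_mat A' (i, j) * vec_index x j)"
        using eq[of i j] xb[of i] xb[of j] by (cases "i \<in> bad"; cases "j \<in> bad") auto
    qed
    moreover have "t' * scalar_prod x (mat_diag n d' *\<^sub>v x) \<le> t * scalar_prod x (mat_diag n d *\<^sub>v x)"
      unfolding scalar_prod_mat_diag[OF x] sum_distrib_left
    proof (rule sum_mono)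
      fix i assume "i \<in> {..<n}"
      then show "t' * (d' i * (vec_index x i)\<^sup>2) \<le> t * (d i * (vec_index x i)\<^sup>2)"
        using le[of i] xb[of i] mult_right_mono[of "t' * d' i" "t * d i" "(vec_index x i)\<^sup>2"]
        by (cases "i \<in> bad") auto
    qed
    ultimately show "scalar_prod x (A *\<^sub>v x) - t * scalar_prod x (mat_diag n d *\<^sub>v x)
        \<le> scalar_prod x (A' *\<^sub>v x) - t' * scalar_prod x (mat_diag n d' *\<^sub>v x)"
      by simp
  qed
  then have "real (card {k. k < n \<and> t < l k}) / n \<le> real (card {k. k < n \<and> t' < l' k}) / n + real (card bad) / n"
    using n by (simp add: divide_right_mono flip: add_divide_distrib of_nat_add)
  then show ?thesis
    using measure_spectral_measure[OF mat_carrier P(4), of "{t<..}"]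
      measure_spectral_measure[OF mat_carrier P'(4), of "{t'<..}"] by simp
qed

section \<open>Weak convergence\<close>

text \<open>Allows size 0 to be skipped: the empty matrix has no eigenvalues, so its spectral
  measure is not a probability measure.\<close>

lemma weakly_converges_Suc_iff:
  "weakly_converges (\<lambda>n. N (Suc n)) \<mu> \<longleftrightarrow> weakly_converges N \<mu>"
  unfolding weakly_converges_def
  by (subst filterlim_sequentially_Suc[where f = "\<lambda>n. integral\<^sup>L (N n) _"]) (rule refl)

lemma real_distribution_cdf_eq:
  assumes "real_distribution M"
  shows "cdf M x = 1 - measure M {x<..}"
proof -
  interpret real_distribution M by fact
  have "measure M (space M - {x<..}) = 1 - measure M {x<..}"
    by (rule prob_compl) simp
  moreover have "space M - {x<..} = {..x}" by auto
  ultimately show ?thesis by (simp add: cdf_def)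
qed

text \<open>At a fixed point the relative shift of size \<eta> becomes an arbitrarily small absolute
  one. Distribution functions at a continuity point of the limit are then squeezed between integrals
  of continuous ramps, to which the known convergence applies.\<close>

lemma weakly_converges_sandwich:
  fixes N N' :: "nat \<Rightarrow> real measure"
  assumes N: "\<And>n. real_distribution (N n)" and N': "\<And>n. real_distribution (N' n)"
    and \<mu>: "real_distribution \<mu>" and conv: "weakly_converges N' \<mu>"
    and le: "\<And>\<eta>::real. 0 < \<eta> \<Longrightarrow> \<eta> < 1 \<Longrightarrow> \<exists>b. b \<longlonglongrightarrow> 0 \<and> (\<forall>\<^sub>F n in sequentially. \<forall>t.
      measure (N n) {t<..} \<le> measure (N' n) {t - \<eta> * \<bar>t\<bar><..} + b n \<and>
      measure (N' n) {t + \<eta> * \<bar>t\<bar><..} \<le> measure (N n) {t<..} + b n)"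
  shows "weakly_converges N \<mu>"
proof -
  interpret \<mu>: real_distribution \<mu> by fact
  have step: "(\<lambda>n. integral\<^sup>L (N' n) (cts_step x y)) \<longlonglongrightarrow> integral\<^sup>L \<mu> (cts_step x y)" if "x < y" for x y
  proof -
    have "continuous_on UNIV (cts_step x y)"
      using uniformly_continuous_imp_continuous cts_step_uniformly_continuous[OF that] by blast
    moreover have "bounded (range (cts_step x y))"
      unfolding bounded_iff using that by (intro exI[of _ 1]) (auto simp: cts_step_def)
    ultimately show ?thesis using conv unfolding weakly_converges_def by blast
  qed
  have "weak_conv_m N \<mu>"
    unfolding weak_conv_m_def weak_conv_def
  proof (intro allI impI)
    fix x assume cont: "isCont (cdf \<mu>) x"
    show "(\<lambda>n. cdf (N n) x) \<longlonglongrightarrow> cdf \<mu> x"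
    proof (rule tendstoI)
      fix e :: real assume e: "0 < e"
      obtain r where r: "0 < r" "\<And>y. \<bar>y - x\<bar> < r \<Longrightarrow> \<bar>cdf \<mu> y - cdf \<mu> x\<bar> < e / 3"
        using cont e unfolding continuous_at_eps_delta dist_real_def
        by (metis divide_pos_pos zero_less_numeral)
      \<comment> \<open>The shift \<open>\<eta> * \<bar>x\<bar>\<close> uses up one \<open>s\<close>
        and the ramp of \<open>cts_step\<close> another, so all points stay within 2 s < r of
        \<open>x\<close>. The denominator \<open>1 + \<bar>x\<bar>\<close> covers x = 0.\<close>
      define s where "s = r / 3"
      define \<eta> where "\<eta> = min (1 / 2) (s / (1 + \<bar>x\<bar>))"
      have s: "0 < s" using r by (simp add: s_def)
      have \<eta>: "0 < \<eta>" "\<eta> < 1" using s by (auto simp: \<eta>_def)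
      have "\<eta> * \<bar>x\<bar> \<le> s / (1 + \<bar>x\<bar>) * \<bar>x\<bar>"
        by (intro mult_right_mono) (auto simp: \<eta>_def)
      also have "\<dots> \<le> s"
        using s by (simp add: field_simps)
      finally have \<eta>x: "\<eta> * \<bar>x\<bar> \<le> s" .
      obtain b where b: "b \<longlonglongrightarrow> 0" and bb: "\<forall>\<^sub>F n in sequentially. \<forall>t.
          measure (N n) {t<..} \<le> measure (N' n) {t - \<eta> * \<bar>t\<bar><..} + b n \<and>
          measure (N' n) {t + \<eta> * \<bar>t\<bar><..} \<le> measure (N n) {t<..} + b n"
        using le[OF \<eta>] by auto
      have "\<forall>\<^sub>F n in sequentially. integral\<^sup>L (N' n) (cts_step (x + s) (x + 2 * s))
          < integral\<^sup>L \<mu> (cts_step (x + s) (x + 2 * s)) + e / 3"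
        using order_tendstoD(2)[OF step[of "x + s" "x + 2 * s"]] s e by simp
      moreover have "\<forall>\<^sub>F n in sequentially. integral\<^sup>L (N' n) (cts_step (x - 2 * s) (x - s))
          > integral\<^sup>L \<mu> (cts_step (x - 2 * s) (x - s)) - e / 3"
        using order_tendstoD(1)[OF step[of "x - 2 * s" "x - s"]] s e by simp
      moreover have "\<forall>\<^sub>F n in sequentially. b n < e / 3"
        using order_tendstoD(2)[OF b, of "e / 3"] e by simp
      ultimately show "\<forall>\<^sub>F n in sequentially. dist (cdf (N n) x) (cdf \<mu> x) < e"
        using bb
      proof eventually_elim
        case (elim n)
        interpret N: real_distribution "N n" by (rule N)
        interpret N': real_distribution "N' n" by (rule N')
        have "cdf (N n) x \<le> cdf (N' n) (x + \<eta> * \<bar>x\<bar>) + b n"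
          and "cdf (N' n) (x - \<eta> * \<bar>x\<bar>) - b n \<le> cdf (N n) x"
          using elim(4)[rule_format, of x] unfolding real_distribution_cdf_eq[OF N] real_distribution_cdf_eq[OF N']
          by auto
        moreover have "cdf (N' n) (x + \<eta> * \<bar>x\<bar>) \<le> cdf (N' n) (x + s)"
          "cdf (N' n) (x - s) \<le> cdf (N' n) (x - \<eta> * \<bar>x\<bar>)"
          using \<eta>x by (auto intro!: N'.cdf_nondecreasing)
        moreover have "cdf (N' n) (x + s) \<le> integral\<^sup>L (N' n) (cts_step (x + s) (x + 2 * s))"
          "integral\<^sup>L (N' n) (cts_step (x - 2 * s) (x - s)) \<le> cdf (N' n) (x - s)"
          "integral\<^sup>L \<mu> (cts_step (x + s) (x + 2 * s)) \<le> cdf \<mu> (x + 2 * s)"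
          "cdf \<mu> (x - 2 * s) \<le> integral\<^sup>L \<mu> (cts_step (x - 2 * s) (x - s))"
          using s by (auto intro!: N'.cdf_cts_step \<mu>.cdf_cts_step)
        moreover have "\<bar>cdf \<mu> (x + 2 * s) - cdf \<mu> x\<bar> < e / 3" "\<bar>cdf \<mu> (x - 2 * s) - cdf \<mu> x\<bar> < e / 3"
          using r by (auto simp: s_def)
        ultimately show ?case
          using elim(1-3) unfolding dist_real_def by linarith
      qed
    qed
  qed
  then show ?thesis
    unfolding weakly_converges_def bounded_iff
    by (auto simp: continuous_on_eq_continuous_at intro!: weak_conv_imp_integral_bdd_continuous_conv[OF N \<mu>])
qed

section \<open>Regularly varying tails of index 1\<close>

locale heavy_tailed_one =
  fixes L :: "real measure"
  assumes heavy: "heavy_tailed 1 L"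
begin

definition tail :: "real \<Rightarrow> real" where "tail t = measure L {t<..}"

text \<open>The truncated mean at an arbitrary real level: limits are taken at infinity first and
  composed with the scale afterwards, and levels T a_n occur besides a_n itself.\<close>

definition trunc :: "real \<Rightarrow> real" where "trunc t = (LINT x:{0..t}|L. x)"

lemma distribution: "real_distribution L"
  using heavy unfolding heavy_tailed_def real_distribution_def real_distribution_axioms_def by auto

sublocale real_distribution L by (rule distribution)

lemma AE_nonneg: "AE x in L. 0 \<le> x"
proof -
  have "measure L {..<0} = 0" using heavy by (simp add: heavy_tailed_def)
  then have "emeasure L {..<0} = 0" by (simp add: emeasure_eq_measure)
  then show ?thesis
    by (intro AE_I[of _ _ "{..<0}"]) auto
qed

lemma tail_ratio:
  assumes x: "0 < x"
  shows "((\<lambda>t. tail (x * t) / tail t) \<longlongrightarrow> 1 / x) at_top"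
proof -
  obtain l where l: "slowly_varying l" "\<And>t. 0 < t \<Longrightarrow> tail t = l t * t powr (- 1)"
    using heavy unfolding heavy_tailed_def tail_def by auto
  have "((\<lambda>t. (l (x * t) / l t) * (1 / x)) \<longlongrightarrow> 1 * (1 / x)) at_top"
    using l(1) x unfolding slowly_varying_def by (intro tendsto_mult tendsto_const) auto
  then show ?thesis
  proof (rule Lim_transform_eventually[THEN tendsto_eq_rhs])
    show "\<forall>\<^sub>F t in at_top. (l (x * t) / l t) * (1 / x) = tail (x * t) / tail t"
      using eventually_gt_at_top[of 0]
    proof eventually_elim
      case (elim t)
      have l_eq: "l s = tail s * s" if "0 < s" for s
        using l(2)[OF that] that by (simp add: powr_minus_divide)
      show ?case
        using x elim by (simp add: l_eq)
    qed
  qed simp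
qed

lemma tail_antimono: "s \<le> t \<Longrightarrow> tail t \<le> tail s"
  unfolding tail_def by (intro finite_measure_mono) auto

text \<open>Since division by 0 yields 0, the limit 1 of \<open>tail t / tail t\<close> excludes
  zeros of the tail arbitrarily far out; monotonicity does the rest.\<close>

lemma tail_pos: "0 < tail t"
proof -
  have "\<forall>\<^sub>F s in at_top. tail (1 * s) / tail s > 0"
    using order_tendstoD(1)[OF tail_ratio[of 1], of 0] by simp
  then obtain s where s: "t \<le> s" "tail (1 * s) / tail s > 0"
    using eventually_happens[OF eventually_conj[OF eventually_ge_at_top[of t]]] by auto
  have "0 \<le> tail s" by (simp add: tail_def)
  then have "0 < tail s" using s(2) by (cases "tail s = 0") auto
  then show ?thesis using tail_antimono[OF s(1)] by simp
qed

lemma tail_eq: "tail t = 1 - cdf L t"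
proof -
  have "prob (space L - {t<..}) = 1 - prob {t<..}"
    by (rule prob_compl) simp
  moreover have "space L - {t<..} = {..t}" by auto
  ultimately show ?thesis by (simp add: cdf_def tail_def)
qed

lemma tail_tendsto_0: "(tail \<longlongrightarrow> 0) at_top"
  using tendsto_diff[OF tendsto_const cdf_lim_at_top_prob, of 1] by (simp add: tail_eq[abs_def])

lemma tail_right_cont: "continuous (at_right t) tail"
  unfolding tail_eq[abs_def] using cdf_is_right_cont by (intro continuous_intros)

section \<open>The scale a_n\<close>

lemma tail_scale_eq: "tail_scale L n = Inf {a. 0 < a \<and> real n * tail a \<le> 1}"
  by (simp add: tail_scale_def tail_def)

lemma tail_scale_bdd: "bdd_below {a. 0 < a \<and> real n * tail a \<le> 1}"
  by (rule bdd_belowI[of _ 0]) auto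

lemma tail_scale_nonempty: "{a. 0 < a \<and> real n * tail a \<le> 1} \<noteq> {}"
proof -
  have "((\<lambda>a. real n * tail a) \<longlongrightarrow> real n * 0) at_top"
    by (intro tendsto_mult tendsto_const tail_tendsto_0)
  from order_tendstoD(2)[OF this, of 1]
  have "\<forall>\<^sub>F a in at_top. 0 < a \<and> real n * tail a < 1"
    using eventually_gt_at_top[of 0] by (auto simp: eventually_conj_iff)
  from eventually_happens[OF this] show ?thesis
    by (auto intro: less_imp_le)
qed

lemma tail_below_scale:
  assumes "0 < a" "a < tail_scale L n"
  shows "1 < real n * tail a"
proof (rule ccontr)
  assume "\<not> ?thesis"
  then have "tail_scale L n \<le> a"
    unfolding tail_scale_eq using assms(1) tail_scale_bdd by (intro cInf_lower) auto
  then show False using assms(2) by simp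
qed

text \<open>Right continuity of the tail passes the defining inequality from points just above the
  infimum to the infimum itself.\<close>

lemma tail_at_scale: "real n * tail (tail_scale L n) \<le> 1"
proof (rule field_le_epsilon)
  fix e :: real assume e: "0 < e"
  have "((\<lambda>a. real n * tail a) \<longlongrightarrow> real n * tail (tail_scale L n)) (at_right (tail_scale L n))"
    using tail_right_cont unfolding continuous_within by (intro tendsto_mult tendsto_const)
  from order_tendstoD(1)[OF this, of "real n * tail (tail_scale L n) - e"] e
  obtain b where b: "tail_scale L n < b"
    "\<And>a. tail_scale L n < a \<Longrightarrow> a < b \<Longrightarrow> real n * tail (tail_scale L n) - e < real n * tail a"
    unfolding eventually_at_right_field by auto
  obtain a where a: "0 < a" "real n * tail a \<le> 1" "a < b"
    using cInf_lessD[OF tail_scale_nonempty, of n b] b(1) unfolding tail_scale_eq by auto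
  \<comment> \<open>The point \<open>a\<close> of the set may be the infimum itself; the midpoint
    pushes \<open>c\<close> strictly above it, and staying above \<open>a\<close> keeps the
    inequality by monotonicity.\<close>
  define c where "c = max a ((tail_scale L n + b) / 2)"
  have "tail_scale L n < c" "c < b" "a \<le> c"
    using a b(1) by (auto simp: c_def less_max_iff_disj)
  then have "real n * tail (tail_scale L n) - e < real n * tail c" "real n * tail c \<le> real n * tail a"
    using b(2) tail_antimono by (auto intro: mult_left_mono)
  then show "real n * tail (tail_scale L n) \<le> 1 + e" using a(2) by simp
qed

text \<open>No level has tail zero, so a fixed level violates the defining inequality once n is
  large, and with it every smaller level.\<close>

lemma tail_scale_at_top: "filterlim (tail_scale L) at_top sequentially"
  unfolding filterlim_at_top
proof
  fix Z :: real
  define B where "B = max Z 1"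
  have "\<forall>\<^sub>F n in sequentially. 1 / tail B < real n"
    using filterlim_real_sequentially eventually_gt_at_top by (simp add: filterlim_at_top_dense)
  then show "\<forall>\<^sub>F n in sequentially. Z \<le> tail_scale L n"
  proof eventually_elim
    case (elim n)
    then have n: "1 < real n * tail B" using tail_pos[of B] by (simp add: field_simps)
    have "B \<le> tail_scale L n"
      unfolding tail_scale_eq
    proof (rule cInf_greatest[OF tail_scale_nonempty])
      fix a assume "a \<in> {a. 0 < a \<and> real n * tail a \<le> 1}"
      then show "B \<le> a"
        using n tail_antimono[of a B] mult_left_mono[of "tail B" "tail a" "real n"] by (cases "B \<le> a") auto
    qed
    then show ?case by (simp add: B_def)
  qed
qed

section \<open>Truncated means and their growth\<close>

lemma integrable_trunc: "set_integrable L {a..b} (\<lambda>x. x)"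
  unfolding set_integrable_def
  by (rule integrable_const_bound[of _ "\<bar>a\<bar> + \<bar>b\<bar>"]) (auto simp: indicator_def)

lemma integrable_trunc': "set_integrable L {a<..b} (\<lambda>x. x)"
  by (rule set_integrable_subset[OF integrable_trunc[of a b]]) auto

lemma measure_Ioc:
  assumes "a \<le> b"
  shows "measure L {a<..b} = tail a - tail b"
proof -
  have "{a<..} = {a<..b} \<union> {b<..}" using assms by auto
  moreover have "measure L ({a<..b} \<union> {b<..}) = measure L {a<..b} + measure L {b<..}"
    by (rule finite_measure_Union) auto
  ultimately show ?thesis by (simp add: tail_def)
qed

lemma trunc_split:
  assumes "0 \<le> a" "a \<le> b"
  shows "trunc b = trunc a + (LINT x:{a<..b}|L. x)"
proof -
  have "{0..b} = {0..a} \<union> {a<..b}" using assms by auto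
  then show ?thesis
    unfolding trunc_def using integrable_trunc integrable_trunc'
    by (simp add: set_integral_Un[of "{0..a}" "{a<..b}"] disjoint_iff)
qed

lemma Ioc_integral_bounds:
  assumes "a \<le> b"
  shows "a * (tail a - tail b) \<le> (LINT x:{a<..b}|L. x)"
    and "(LINT x:{a<..b}|L. x) \<le> b * (tail a - tail b)"
proof -
  have c: "set_integrable L {a<..b} (\<lambda>_. c)" "(LINT x:{a<..b}|L. c) = c * (tail a - tail b)" for c :: real
    using measure_Ioc[OF assms]
    by (auto simp: set_integrable_def set_lebesgue_integral_def emeasure_eq_measure mult.commute)
  show "a * (tail a - tail b) \<le> (LINT x:{a<..b}|L. x)"
    unfolding c(2)[symmetric] by (intro set_integral_mono c(1) integrable_trunc') auto
  show "(LINT x:{a<..b}|L. x) \<le> b * (tail a - tail b)"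
    unfolding c(2)[symmetric] by (intro set_integral_mono c(1) integrable_trunc') auto
qed

lemma trunc_nonneg: "0 \<le> trunc t"
  unfolding trunc_def set_lebesgue_integral_def
  by (rule Bochner_Integration.integral_nonneg) (auto simp: indicator_def)

lemma trunc_mono:
  assumes "0 \<le> a" "a \<le> b"
  shows "trunc a \<le> trunc b"
proof -
  have "0 \<le> a * (tail a - tail b)" using assms tail_antimono[of a b] by simp
  then show ?thesis
    using trunc_split[OF assms] Ioc_integral_bounds(1)[OF assms(2)] by simp
qed

text \<open>On the shell from t / 2^(k+1) to t / 2^k the integrand is at least the left endpoint;
  the shells are disjoint, so the bounds add up.\<close>

lemma trunc_dyadic:
  assumes "0 \<le> t"
  shows "(\<Sum>k<m. t / 2 ^ Suc k * (tail (t / 2 ^ Suc k) - tail (t / 2 ^ k))) \<le> trunc t - trunc (t / 2 ^ m)"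
proof (induction m)
  case (Suc m)
  have le: "0 \<le> t / 2 ^ Suc m" "t / 2 ^ Suc m \<le> t / 2 ^ m"
    using assms by (auto simp: field_simps)
  show ?case
    using Suc trunc_split[OF le] Ioc_integral_bounds(1)[OF le(2)] by simp
qed simp

text \<open>Index 1 is critical in Karamata's theorem: each of the dyadic shells below \<open>t\<close> contributes
  the same amount, about \<open>t * tail t / 2\<close>, to the truncated mean.\<close>

lemma trunc_over_tail_at_top: "filterlim (\<lambda>t. trunc t / (t * tail t)) at_top at_top"
  unfolding filterlim_at_top
proof
  fix Z :: real
  \<comment> \<open>Relative to \<open>t * tail t\<close>, each of the \<open>m\<close> shells
    contributes in the limit 2^-(k+1) (2^(k+1) - 2^k) = 1/2, so \<open>m\<close> shells exceed
    \<open>Z\<close> when m / 2 does.\<close>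
  obtain m :: nat where m: "Z < real m / 2"
    using reals_Archimedean2[of "2 * Z"] by (auto simp: field_simps)
  define f where "f t = (\<Sum>k<m. 1 / 2 ^ Suc k *
    (tail (1 / 2 ^ Suc k * t) / tail t - tail (1 / 2 ^ k * t) / tail t))" for t
  have "(f \<longlongrightarrow> (\<Sum>k<m. 1 / 2 ^ Suc k * (1 / (1 / 2 ^ Suc k) - 1 / (1 / 2 ^ k)))) at_top"
    unfolding f_def by (intro tendsto_sum tendsto_mult tendsto_const tendsto_diff tail_ratio) auto
  moreover have "(\<Sum>k<m. 1 / 2 ^ Suc k * (1 / (1 / 2 ^ Suc k) - 1 / (1 / 2 ^ k))) = (real m / 2 :: real)"
    by (simp add: field_simps)
  ultimately have "(f \<longlongrightarrow> real m / 2) at_top" by simp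
  from order_tendstoD(1)[OF this m] eventually_gt_at_top[of 0]
  show "\<forall>\<^sub>F t in at_top. Z \<le> trunc t / (t * tail t)"
  proof eventually_elim
    case (elim t)
    have "f t * (t * tail t) = (\<Sum>k<m. t / 2 ^ Suc k * (tail (t / 2 ^ Suc k) - tail (t / 2 ^ k)))"
      unfolding f_def sum_distrib_right using tail_pos[of t]
      by (intro sum.cong refl) (simp add: field_simps)
    also have "\<dots> \<le> trunc t"
      using trunc_dyadic[of t m] elim trunc_nonneg[of "t / 2 ^ m"] by simp
    finally have "f t \<le> trunc t / (t * tail t)"
      using elim tail_pos[of t] by (simp add: pos_le_divide_eq)
    then show ?case using elim by simp
  qed
qed

lemma truncated_mean_eq: "truncated_mean L n = trunc (tail_scale L n)"
  by (simp add: truncated_mean_def trunc_def)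

text \<open>The tail may jump at a_n, but at a_n / 2 the product with n still exceeds 1. Doubling
  the argument asymptotically divides the tail by 2, and the factor 3 leaves room.\<close>

lemma tail_scale_lower: "\<forall>\<^sub>F n in sequentially. 1 \<le> 3 * (real n * tail (tail_scale L n))"
proof -
  have "\<forall>\<^sub>F t in at_top. tail (1/2 * t) / tail t < 3"
    using order_tendstoD(2)[OF tail_ratio[of "1/2"], of 3] by simp
  then have "\<forall>\<^sub>F n in sequentially. tail (1/2 * tail_scale L n) / tail (tail_scale L n) < 3"
    using tail_scale_at_top by (rule eventually_compose_filterlim)
  moreover have "\<forall>\<^sub>F n in sequentially. 0 < tail_scale L n"
    using tail_scale_at_top by (simp add: filterlim_at_top_dense)
  ultimately show ?thesis
  proof eventually_elim
    case (elim n)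
    have "1 < real n * tail (1/2 * tail_scale L n)"
      using elim by (intro tail_below_scale) auto
    also have "\<dots> \<le> real n * (3 * tail (tail_scale L n))"
      using elim(1) tail_pos[of "tail_scale L n"] by (intro mult_left_mono) (auto simp: field_simps)
    finally show ?case by simp
  qed
qed

lemma truncated_mean_pos: "\<forall>\<^sub>F n in sequentially. 0 < truncated_mean L n"
proof -
  have "\<forall>\<^sub>F t in at_top. 0 < trunc t / (t * tail t)"
    using trunc_over_tail_at_top by (simp add: filterlim_at_top_dense)
  then have "\<forall>\<^sub>F t in at_top. 0 < trunc t"
    by eventually_elim (metis div_0 less_irrefl order_le_less trunc_nonneg)
  then show ?thesis
    unfolding truncated_mean_eq using tail_scale_at_top by (rule eventually_compose_filterlim)
qed

text \<open>The mean w_n dominates a_n \<open>tail\<close>(a_n), which is at least a_n / (3 n) by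
  \<open>tail_scale_lower\<close>. Thus the centering n w_n of a row sum outgrows a_n, the order of
  its large weights.\<close>

lemma tail_scale_over_mean: "(\<lambda>n. tail_scale L n / (real n * truncated_mean L n)) \<longlonglongrightarrow> 0"
proof (rule tendstoI)
  fix e :: real assume e: "0 < e"
  have "\<forall>\<^sub>F t in at_top. 3 / e < trunc t / (t * tail t)"
    using trunc_over_tail_at_top by (simp add: filterlim_at_top_dense)
  then have "\<forall>\<^sub>F n in sequentially. 3 / e < truncated_mean L n / (tail_scale L n * tail (tail_scale L n))"
    unfolding truncated_mean_eq using tail_scale_at_top by (rule eventually_compose_filterlim)
  moreover have "\<forall>\<^sub>F n in sequentially. 0 < tail_scale L n"
    using tail_scale_at_top by (simp add: filterlim_at_top_dense)
  ultimately show "\<forall>\<^sub>F n in sequentially. dist (tail_scale L n / (real n * truncated_mean L n)) 0 < e"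
    using tail_scale_lower truncated_mean_pos eventually_gt_at_top[of 0]
  proof eventually_elim
    case (elim n)
    let ?a = "tail_scale L n" and ?w = "truncated_mean L n"
    have "3 * (?a * tail ?a) < e * ?w"
      using elim e tail_pos[of ?a] by (simp add: field_simps)
    then have "real n * (3 * (?a * tail ?a)) < real n * (e * ?w)"
      using elim by (intro mult_strict_left_mono) auto
    moreover have "?a * 1 \<le> ?a * (3 * (real n * tail ?a))"
      using elim by (intro mult_left_mono) auto
    ultimately have "?a < e * (real n * ?w)"
      by (simp add: algebra_simps)
    then show ?case
      using elim by (simp add: field_simps)
  qed
qed

text \<open>The left side bounds the probability that one of n weights exceeds T a_n. Regular
  variation makes it asymptotically at most 1 / T, hence small for large \<open>T\<close>.\<close>

lemma tail_multiple_scale: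
  assumes T: "0 < T" and e: "1 / T < e"
  shows "\<forall>\<^sub>F n in sequentially. real n * tail (T * tail_scale L n) \<le> e"
proof -
  have "\<forall>\<^sub>F t in at_top. tail (T * t) / tail t < e"
    using order_tendstoD(2)[OF tail_ratio[OF T] e] .
  then have "\<forall>\<^sub>F n in sequentially. tail (T * tail_scale L n) / tail (tail_scale L n) < e"
    using tail_scale_at_top by (rule eventually_compose_filterlim)
  then show ?thesis
  proof eventually_elim
    case (elim n)
    let ?a = "tail_scale L n"
    have "0 < e"
      using T e by (intro less_trans[OF _ e]) simp
    have "real n * tail (T * ?a) \<le> real n * (e * tail ?a)"
      using elim tail_pos[of ?a] by (intro mult_left_mono) (auto simp: field_simps)
    also have "\<dots> = e * (real n * tail ?a)" by simp
    also have "\<dots> \<le> e * 1"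
      using \<open>0 < e\<close> tail_at_scale by (intro mult_left_mono) auto
    finally show ?case by simp
  qed
qed

text \<open>Between a_n and T a_n there is mass at most 1 / n, and the values are at most T a_n.
  Raising the truncation level therefore moves the mean by at most T a_n / n, which is negligible
  against w_n.\<close>

lemma trunc_multiple_scale:
  assumes T: "1 \<le> T" and n: "0 < n" and a: "0 \<le> tail_scale L n"
  shows "truncated_mean L n \<le> trunc (T * tail_scale L n)"
    and "trunc (T * tail_scale L n) \<le> truncated_mean L n + T * tail_scale L n / real n"
proof -
  let ?a = "tail_scale L n"
  have le: "?a \<le> T * ?a"
    using mult_right_mono[OF T a] by simp
  show "truncated_mean L n \<le> trunc (T * ?a)"
    unfolding truncated_mean_eq using a le by (rule trunc_mono)
  have "(LINT x:{?a<..T * ?a}|L. x) \<le> T * ?a * (tail ?a - tail (T * ?a))"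
    by (rule Ioc_integral_bounds(2)[OF le])
  also have "\<dots> \<le> T * ?a * (1 / real n)"
    using T a n tail_at_scale[of n] tail_pos[of "T * ?a"]
    by (intro mult_left_mono) (auto simp: field_simps add_increasing2)
  finally show "trunc (T * ?a) \<le> truncated_mean L n + T * ?a / real n"
    unfolding truncated_mean_eq using trunc_split[OF a le] by simp
qed

end

section \<open>Row sums\<close>

lemma card_eq_sum_indicator:
  fixes n :: nat
  shows "real (card {i. i < n \<and> f i \<in> B i}) = (\<Sum>i<n. indicat_real (B i) (f i))"
proof -
  have "{i. i < n \<and> f i \<in> B i} = {..<n} \<inter> {i. f i \<in> B i}" by auto
  then show ?thesis by (simp add: indicator_def sum_of_bool_eq)
qed

context prob_space
begin

section \<open>A weak law for sums of heavy-tailed weights\<close>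

text \<open>The first term is the union bound for some weight exceeding \<open>b\<close>. Otherwise
  almost surely the sum equals the sum of the truncated weights; each of these has variance at most
  \<open>b * m\<close>, and Chebyshev's inequality gives the second term.\<close>

lemma truncated_sum_deviation:
  fixes X :: "'i \<Rightarrow> 'a \<Rightarrow> real" and b r m :: real
  assumes fin: "finite J" and ind: "indep_vars (\<lambda>_. borel) X J"
    and distr: "\<And>j. j \<in> J \<Longrightarrow> distr M borel (X j) = L"
    and nonneg: "AE x in L. 0 \<le> x" and b: "0 \<le> b" and r: "0 < r"
  defines "m \<equiv> (LINT x:{0..b}|L. x)"
  shows "prob {\<omega>\<in>space M. r \<le> \<bar>(\<Sum>j\<in>J. X j \<omega>) - card J * m\<bar>}
    \<le> card J * measure L {b<..} + card J * (b * m) / r\<^sup>2"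
proof (cases "J = {}")
  case True
  then show ?thesis using r by simp
next
  case False
  have rv [measurable]: "random_variable borel (X j)" if "j \<in> J" for j
    using ind that by (auto simp: indep_vars_def)
  define g where "g x = indicator {0..b} x * x" for x :: real
  have g [measurable]: "g \<in> borel_measurable borel" by (simp add: g_def[abs_def])
  have gb: "\<bar>g x\<bar> \<le> b" "0 \<le> g x" for x using b by (auto simp: g_def indicator_def)
  have g_int: "integrable M (\<lambda>\<omega>. g (X j \<omega>))" "expectation (\<lambda>\<omega>. g (X j \<omega>)) = m" if "j \<in> J" for j
  proof -
    show "integrable M (\<lambda>\<omega>. g (X j \<omega>))"
      using that gb by (intro integrable_const_bound[of _ b]) auto
    have "expectation (\<lambda>\<omega>. g (X j \<omega>)) = integral\<^sup>L (distr M borel (X j)) g"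
      using that by (intro integral_distr[symmetric]) auto
    also have "\<dots> = m"
      using distr[OF that] by (simp add: m_def set_lebesgue_integral_def g_def[abs_def])
    finally show "expectation (\<lambda>\<omega>. g (X j \<omega>)) = m" .
  qed
  define W where "W j \<omega> = g (X j \<omega>) - m" for j \<omega>
  have W [measurable]: "random_variable borel (W j)" if "j \<in> J" for j
    using that by (simp add: W_def[abs_def])
  have W_ind: "indep_vars (\<lambda>_. borel) W J"
    unfolding W_def[abs_def] by (rule indep_vars_compose2[OF ind]) simp
  have W_int: "integrable M (W j)" "expectation (W j) = 0" if "j \<in> J" for j
    using g_int[OF that] by (auto simp: W_def[abs_def] prob_space)
  have W2_int: "integrable M (\<lambda>\<omega>. (W j \<omega>)\<^sup>2)" and W2: "expectation (\<lambda>\<omega>. (W j \<omega>)\<^sup>2) \<le> b * m" if "j \<in> J" for j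
  proof -
    have int2: "integrable M (\<lambda>\<omega>. (g (X j \<omega>))\<^sup>2)"
      using that gb by (intro integrable_const_bound[of _ "b\<^sup>2"])
        (auto simp: abs_le_square_iff[symmetric] b)
    have sq: "(W j \<omega>)\<^sup>2 = (g (X j \<omega>))\<^sup>2 - 2 * m * g (X j \<omega>) + m\<^sup>2" for \<omega>
      by (simp add: W_def power2_diff)
    show "integrable M (\<lambda>\<omega>. (W j \<omega>)\<^sup>2)"
      unfolding sq using int2 g_int(1)[OF that] by simp
    have "expectation (\<lambda>\<omega>. (W j \<omega>)\<^sup>2) = expectation (\<lambda>\<omega>. (g (X j \<omega>))\<^sup>2) - m\<^sup>2"
      unfolding sq using int2 g_int[OF that] by (simp add: prob_space power2_eq_square)
    also have "\<dots> \<le> expectation (\<lambda>\<omega>. (g (X j \<omega>))\<^sup>2)" by simp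
    also have "\<dots> \<le> expectation (\<lambda>\<omega>. b * g (X j \<omega>))"
    proof (rule integral_mono[OF int2])
      show "(g (X j \<omega>))\<^sup>2 \<le> b * g (X j \<omega>)" for \<omega>
        using gb[of "X j \<omega>"] unfolding power2_eq_square by (intro mult_right_mono) auto
    qed (use g_int(1)[OF that] in simp)
    also have "\<dots> = b * m" using g_int[OF that] by simp
    finally show "expectation (\<lambda>\<omega>. (W j \<omega>)\<^sup>2) \<le> b * m" .
  qed
  \<comment> \<open>By independence the cross terms vanish, so the second moment of the centered sum
    is the sum of the variances.\<close>
  have prod_int: "integrable M (\<lambda>\<omega>. W i \<omega> * W j \<omega>)"
    and prod_0: "i \<noteq> j \<Longrightarrow> expectation (\<lambda>\<omega>. W i \<omega> * W j \<omega>) = 0" if "i \<in> J" "j \<in> J" for i j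
  proof -
    show "i \<noteq> j \<Longrightarrow> expectation (\<lambda>\<omega>. W i \<omega> * W j \<omega>) = 0"
      using indep_vars_lebesgue_integral[of "{i, j}" W] indep_vars_subset[OF W_ind, of "{i, j}"]
        W_int that by auto
    show "integrable M (\<lambda>\<omega>. W i \<omega> * W j \<omega>)"
    proof (cases "i = j")
      case True
      then show ?thesis using W2_int[OF that(1)] by (simp add: power2_eq_square)
    next
      case False
      then show ?thesis
        using indep_vars_integrable[of "{i, j}" W] indep_vars_subset[OF W_ind, of "{i, j}"] W_int that by auto
    qed
  qed
  define S where "S \<omega> = (\<Sum>j\<in>J. W j \<omega>)" for \<omega>
  have S [measurable]: "random_variable borel S" by (simp add: S_def[abs_def])
  have S2: "(S \<omega>)\<^sup>2 = (\<Sum>i\<in>J. \<Sum>j\<in>J. W i \<omega> * W j \<omega>)" for \<omega>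
    by (simp add: S_def power2_eq_square sum_product)
  have S2_int: "integrable M (\<lambda>\<omega>. (S \<omega>)\<^sup>2)"
    unfolding S2 using prod_int by (intro Bochner_Integration.integrable_sum) auto
  have "expectation (\<lambda>\<omega>. (S \<omega>)\<^sup>2) = (\<Sum>i\<in>J. \<Sum>j\<in>J. expectation (\<lambda>\<omega>. W i \<omega> * W j \<omega>))"
    unfolding S2 using prod_int
    by (subst Bochner_Integration.integral_sum, force)+ simp
  also have "\<dots> = (\<Sum>i\<in>J. expectation (\<lambda>\<omega>. (W i \<omega>)\<^sup>2))"
  proof (intro sum.cong refl)
    fix i assume "i \<in> J"
    then have "(\<Sum>j\<in>J. expectation (\<lambda>\<omega>. W i \<omega> * W j \<omega>))
        = (\<Sum>j\<in>J. if j = i then expectation (\<lambda>\<omega>. (W i \<omega>)\<^sup>2) else 0)"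
      using prod_0 by (intro sum.cong refl) (auto simp: power2_eq_square)
    then show "(\<Sum>j\<in>J. expectation (\<lambda>\<omega>. W i \<omega> * W j \<omega>)) = expectation (\<lambda>\<omega>. (W i \<omega>)\<^sup>2)"
      using \<open>i \<in> J\<close> fin by simp
  qed
  also have "\<dots> \<le> card J * (b * m)"
    using sum_mono[of J "\<lambda>i. expectation (\<lambda>\<omega>. (W i \<omega>)\<^sup>2)" "\<lambda>_. b * m"] W2 by simp
  finally have ES2: "expectation (\<lambda>\<omega>. (S \<omega>)\<^sup>2) \<le> card J * (b * m)" .
  have cheb: "prob {\<omega>\<in>space M. r \<le> \<bar>S \<omega>\<bar>} \<le> card J * (b * m) / r\<^sup>2"
    using second_moment_method[OF S S2_int r] ES2 by (meson divide_right_mono order_trans zero_le_power2)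
  have X_nonneg: "AE \<omega> in M. \<forall>j\<in>J. 0 \<le> X j \<omega>"
  proof (rule AE_finite_allI[OF fin])
    fix j assume "j \<in> J"
    then show "AE \<omega> in M. 0 \<le> X j \<omega>"
      using AE_distrD[of "X j" M borel "\<lambda>x. 0 \<le> x"] nonneg distr[OF \<open>j \<in> J\<close>] by auto
  qed
  have ev: "(\<Union>j\<in>J. {\<omega>\<in>space M. b < X j \<omega>}) \<in> events" "{\<omega>\<in>space M. r \<le> \<bar>S \<omega>\<bar>} \<in> events"
    using fin by (auto intro!: sets.finite_UN)
  have "prob {\<omega>\<in>space M. r \<le> \<bar>(\<Sum>j\<in>J. X j \<omega>) - card J * m\<bar>}
      \<le> prob ((\<Union>j\<in>J. {\<omega>\<in>space M. b < X j \<omega>}) \<union> {\<omega>\<in>space M. r \<le> \<bar>S \<omega>\<bar>})"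
  proof (rule finite_measure_mono_AE)
    show "AE \<omega> in M. \<omega> \<in> {\<omega>\<in>space M. r \<le> \<bar>(\<Sum>j\<in>J. X j \<omega>) - card J * m\<bar>} \<longrightarrow>
        \<omega> \<in> (\<Union>j\<in>J. {\<omega>\<in>space M. b < X j \<omega>}) \<union> {\<omega>\<in>space M. r \<le> \<bar>S \<omega>\<bar>}"
      using X_nonneg
    proof eventually_elim
      case (elim \<omega>)
      have "S \<omega> = (\<Sum>j\<in>J. X j \<omega>) - card J * m" if "\<forall>j\<in>J. X j \<omega> \<le> b"
      proof -
        have "S \<omega> = (\<Sum>j\<in>J. X j \<omega> - m)"
          unfolding S_def W_def g_def using that elim by (intro sum.cong) auto
        then show ?thesis by (simp add: sum_subtractf)
      qed
      then show ?case by (auto simp: not_less) force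
    qed
  qed (use ev in auto)
  also have "\<dots> \<le> prob (\<Union>j\<in>J. {\<omega>\<in>space M. b < X j \<omega>}) + prob {\<omega>\<in>space M. r \<le> \<bar>S \<omega>\<bar>}"
    using ev by (intro measure_Un_le) auto
  also have "prob (\<Union>j\<in>J. {\<omega>\<in>space M. b < X j \<omega>}) \<le> (\<Sum>j\<in>J. prob {\<omega>\<in>space M. b < X j \<omega>})"
    using fin by (intro finite_measure_subadditive_finite) auto
  also have "(\<Sum>j\<in>J. prob {\<omega>\<in>space M. b < X j \<omega>}) = (\<Sum>j\<in>J. measure L {b<..})"
  proof (intro sum.cong refl)
    fix j assume j: "j \<in> J"
    have "measure (distr M borel (X j)) {b<..} = prob (X j -` {b<..} \<inter> space M)"
      using j by (intro measure_distr) auto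
    also have "X j -` {b<..} \<inter> space M = {\<omega>\<in>space M. b < X j \<omega>}" by auto
    finally show "prob {\<omega>\<in>space M. b < X j \<omega>} = measure L {b<..}" using distr[OF j] by simp
  qed
  finally show ?thesis using cheb by simp
qed

text \<open>The threshold for n is uniform over the index set and the family, because it is later
  applied to up to n row pieces of different lengths at once. Each sum is centered according to its
  own number of terms.\<close>

lemma heavy_tailed_one_weak_law:
  fixes e \<eta> :: real
  assumes L: "heavy_tailed 1 L" and \<eta>: "0 < \<eta>" and e: "0 < e"
  shows "\<forall>\<^sub>F n in sequentially. \<forall>(J :: 'i set) X. finite J \<longrightarrow> card J \<le> n \<longrightarrow>
    indep_vars (\<lambda>_. borel) X J \<longrightarrow> (\<forall>j\<in>J. distr M borel (X j) = L) \<longrightarrow>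
    prob {\<omega>\<in>space M. \<eta> * (n * truncated_mean L n) \<le> \<bar>(\<Sum>j\<in>J. X j \<omega>) - card J * truncated_mean L n\<bar>} \<le> e"
proof -
  interpret H: heavy_tailed_one L by unfold_locales fact
  \<comment> \<open>Makes 1 / T < e / 2, so that weights above T a_n cost at most half of the
    allowed probability.\<close>
  define T where "T = 1 + 2 / e"
  have T: "1 \<le> T" "0 < T" "1 / T < e / 2"
    using e by (auto simp: T_def field_simps add_pos_pos)
  define q where "q n = tail_scale L n / (real n * truncated_mean L n)" for n
  \<comment> \<open>The first sequence controls the change of centering and yields m \<le> 2 w_n;
    the second is the Chebyshev term obtained below with r = \<eta> n w_n / 2.\<close>
  have q0: "(\<lambda>n. T * q n) \<longlonglongrightarrow> T * 0" "(\<lambda>n. 8 / \<eta>\<^sup>2 * (T * q n)) \<longlonglongrightarrow> 8 / \<eta>\<^sup>2 * (T * 0)"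
    unfolding q_def by (intro tendsto_mult tendsto_const H.tail_scale_over_mean)+
  have "\<forall>\<^sub>F n in sequentially. T * q n < min (\<eta> / 2) 1"
    using order_tendstoD(2)[OF q0(1), of "min (\<eta> / 2) 1"] \<eta> by simp
  moreover have "\<forall>\<^sub>F n in sequentially. 8 / \<eta>\<^sup>2 * (T * q n) < e / 2"
    using order_tendstoD(2)[OF q0(2), of "e / 2"] e by simp
  moreover have "\<forall>\<^sub>F n in sequentially. 0 < tail_scale L n"
    using H.tail_scale_at_top by (simp add: filterlim_at_top_dense)
  ultimately show ?thesis
    using H.tail_multiple_scale[OF T(2,3)] H.truncated_mean_pos eventually_gt_at_top[of 0]
  proof eventually_elim
    case (elim n)
    let ?a = "tail_scale L n" and ?w = "truncated_mean L n"
    define m where "m = H.trunc (T * ?a)"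
    have a_eq: "?a = q n * (n * ?w)" using elim by (simp add: q_def)
    have m: "?w \<le> m" "m \<le> ?w + T * ?a / n"
      using H.trunc_multiple_scale[OF T(1), of n] elim by (auto simp: m_def)
    have Ta: "T * ?a / n = T * q n * ?w"
      using elim by (simp add: a_eq)
    also have "\<dots> \<le> 1 * ?w" using elim by (intro mult_right_mono) auto
    finally have m2: "m \<le> 2 * ?w" using m by simp
    show ?case
    proof (intro allI impI)
      fix J :: "'i set" and X
      assume J: "finite J" "card J \<le> n" "indep_vars (\<lambda>_. borel) X J" "\<forall>j\<in>J. distr M borel (X j) = L"
      \<comment> \<open>Half of the deviation pays for replacing w_n by the mean \<open>m\<close>
        truncated at T a_n; the other half remains for Chebyshev's inequality.\<close>
      define r where "r = \<eta> / 2 * (n * ?w)"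
      have r: "0 < r" using \<eta> elim by (simp add: r_def)
      have "\<bar>card J * ?w - card J * m\<bar> = card J * (m - ?w)"
        using m by (subst abs_minus_commute) (simp add: right_diff_distrib[symmetric] abs_mult)
      also have "\<dots> \<le> n * (T * q n * ?w)"
        using J(2) m elim Ta by (intro mult_mono) auto
      also have "\<dots> = T * q n * (n * ?w)" by simp
      also have "\<dots> \<le> \<eta> / 2 * (n * ?w)" using elim by (intro mult_right_mono) auto
      finally have close: "\<bar>card J * ?w - card J * m\<bar> \<le> r" by (simp add: r_def)
      have [measurable]: "random_variable borel (X j)" if "j \<in> J" for j
        using J(3) that by (auto simp: indep_vars_def)
      have "prob {\<omega>\<in>space M. \<eta> * (n * ?w) \<le> \<bar>(\<Sum>j\<in>J. X j \<omega>) - card J * ?w\<bar>}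
          \<le> prob {\<omega>\<in>space M. r \<le> \<bar>(\<Sum>j\<in>J. X j \<omega>) - card J * m\<bar>}"
      proof (rule finite_measure_mono)
        have "\<eta> * (n * ?w) = 2 * r" by (simp add: r_def)
        then show "{\<omega>\<in>space M. \<eta> * (n * ?w) \<le> \<bar>(\<Sum>j\<in>J. X j \<omega>) - card J * ?w\<bar>}
            \<subseteq> {\<omega>\<in>space M. r \<le> \<bar>(\<Sum>j\<in>J. X j \<omega>) - card J * m\<bar>}"
          using close by auto
      qed measurable
      also have "\<dots> \<le> card J * measure L {T * ?a<..} + card J * (T * ?a * m) / r\<^sup>2"
        unfolding m_def H.trunc_def using J T elim
        by (intro truncated_sum_deviation[OF J(1,3) _ H.AE_nonneg _ r]) auto
      also have "card J * measure L {T * ?a<..} \<le> n * H.tail (T * ?a)"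
        unfolding H.tail_def using J(2) by (intro mult_right_mono) auto
      also have "n * H.tail (T * ?a) \<le> e / 2" using elim by simp
      also have "card J * (T * ?a * m) / r\<^sup>2 \<le> n * (T * ?a * (2 * ?w)) / r\<^sup>2"
        using J(2) m m2 T elim by (intro divide_right_mono mult_mono) auto
      also have "\<dots> = 8 / \<eta>\<^sup>2 * (T * q n)"
        using \<eta> elim by (simp add: r_def a_eq power2_eq_square field_simps)
      also have "\<dots> \<le> e / 2" using elim by simp
      finally show "prob {\<omega>\<in>space M. \<eta> * (n * ?w) \<le> \<bar>(\<Sum>j\<in>J. X j \<omega>) - card J * ?w\<bar>} \<le> e"
        by simp
    qed
  qed
qed

section \<open>Almost sure bounds on the number of bad rows\<close>

text \<open>Sums over disjoint blocks are independent, so the count is a sum of independent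
  indicators with mean at most \<open>e * n\<close>. Hoeffding's inequality bounds the probability
  of a further excess \<open>e * n\<close>.\<close>

lemma count_block_events:
  fixes X :: "'i \<Rightarrow> 'a \<Rightarrow> real" and K :: "nat \<Rightarrow> 'i set"
  assumes ind: "indep_vars (\<lambda>_. borel) X I" and n: "0 < n"
    and K: "\<And>i. i < n \<Longrightarrow> K i \<subseteq> I" and disj: "disjoint_family_on K {..<n}"
    and B: "\<And>i. i < n \<Longrightarrow> B i \<in> sets borel" and e: "0 \<le> e"
    and le: "\<And>i. i < n \<Longrightarrow> prob {\<omega>\<in>space M. (\<Sum>p\<in>K i. X p \<omega>) \<in> B i} \<le> e"
  shows "prob {\<omega>\<in>space M. 2 * e * n \<le> card {i. i < n \<and> (\<Sum>p\<in>K i. X p \<omega>) \<in> B i}}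
    \<le> exp (- 2 * e\<^sup>2 * n)"
proof -
  define Y where "Y i \<omega> = indicat_real (B i) (\<Sum>p\<in>K i. X p \<omega>)" for i \<omega>
  have "indep_vars (\<lambda>_. borel) (\<lambda>i \<omega>. indicat_real (B i) (\<Sum>p\<in>K i. (restrict (\<lambda>p. X p \<omega>) (K i)) p)) {..<n}"
  proof (rule indep_vars_compose2[OF indep_vars_restrict[OF ind _ disj]])
    show "(\<lambda>f. indicat_real (B i) (\<Sum>p\<in>K i. f p)) \<in> borel_measurable (PiM (K i) (\<lambda>_. borel))"
      if "i \<in> {..<n}" for i
    proof -
      have [measurable]: "B i \<in> sets borel" using B that by auto
      show ?thesis by measurable
    qed
  qed (use K in auto)
  then have Y: "indep_vars (\<lambda>_. borel) Y {..<n}"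
    by (simp add: Y_def[abs_def] cong: sum.cong)
  interpret Hoeffding_ineq M "{..<n}" Y "\<lambda>_. 0" "\<lambda>_. 1" "\<Sum>i<n. expectation (Y i)"
    by unfold_locales (use Y in \<open>auto simp: Y_def indicator_def\<close>)
  have rvY: "random_variable borel (Y i)" if "i < n" for i
    using Y that by (auto simp: indep_vars_def)
  have EY: "expectation (Y i) \<le> e" if "i < n" for i
  proof -
    have Yset: "{\<omega>\<in>space M. (\<Sum>p\<in>K i. X p \<omega>) \<in> B i} = Y i -` {1} \<inter> space M"
      by (auto simp: Y_def indicator_def)
    then have ev: "{\<omega>\<in>space M. (\<Sum>p\<in>K i. X p \<omega>) \<in> B i} \<in> events"
      using rvY[OF that] by (simp add: measurable_sets)
    have "expectation (Y i) = expectation (indicator {\<omega>\<in>space M. (\<Sum>p\<in>K i. X p \<omega>) \<in> B i})"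
      by (intro Bochner_Integration.integral_cong) (auto simp: Y_def indicator_def)
    then show ?thesis using le[OF that] ev by (simp add: Int_absorb2 sets.sets_into_space)
  qed
  have "(\<Sum>i<n. expectation (Y i)) \<le> (\<Sum>i<n. e)"
    using EY by (intro sum_mono) auto
  then have sum: "(\<Sum>i<n. expectation (Y i)) + e * n \<le> 2 * e * n" by (simp add: mult.commute)
  have count: "real (card {i. i < n \<and> (\<Sum>p\<in>K i. X p \<omega>) \<in> B i}) = (\<Sum>i<n. Y i \<omega>)" for \<omega>
    unfolding Y_def by (rule card_eq_sum_indicator)
  have "prob {\<omega>\<in>space M. 2 * e * n \<le> card {i. i < n \<and> (\<Sum>p\<in>K i. X p \<omega>) \<in> B i}}
      \<le> prob {\<omega>\<in>space M. (\<Sum>i<n. expectation (Y i)) + e * n \<le> (\<Sum>i<n. Y i \<omega>)}"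
    unfolding count using sum rvY by (intro finite_measure_mono) auto
  also have "\<dots> \<le> exp (- 2 * (e * n)\<^sup>2 / (\<Sum>i<n. (1 - 0)\<^sup>2))"
    using e n by (intro Hoeffding_ineq_ge) auto
  also have "- 2 * (e * n)\<^sup>2 / (\<Sum>i<n. (1 - 0)\<^sup>2) = - 2 * e\<^sup>2 * n"
    using n by (simp add: power2_eq_square)
  finally show ?thesis .
qed

text \<open>The weak law only makes each single deviation unlikely; Hoeffding turns this into an
  exponentially small, hence summable, probability of many deviations at the same n.\<close>

lemma AE_few_block_deviations:
  fixes X :: "'i \<Rightarrow> 'a \<Rightarrow> real" and K :: "nat \<Rightarrow> nat \<Rightarrow> 'i set" and e \<eta> :: real
  assumes L: "heavy_tailed 1 L" and ind: "indep_vars (\<lambda>_. borel) X I"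
    and distr: "\<And>p. p \<in> I \<Longrightarrow> distr M borel (X p) = L"
    and K: "\<And>n i. i < n \<Longrightarrow> K n i \<subseteq> I" "\<And>n i. i < n \<Longrightarrow> finite (K n i)"
      "\<And>n i. i < n \<Longrightarrow> card (K n i) \<le> n"
    and disj: "\<And>n. disjoint_family_on (K n) {..<n}" and e: "0 < e" and \<eta>: "0 < \<eta>"
  shows "AE \<omega> in M. \<forall>\<^sub>F n in sequentially. card {i. i < n \<and> \<eta> * (n * truncated_mean L n)
    \<le> \<bar>(\<Sum>p\<in>K n i. X p \<omega>) - card (K n i) * truncated_mean L n\<bar>} < 2 * e * n"
proof -
  define B where "B n i = {z. \<eta> * (n * truncated_mean L n) \<le> \<bar>z - card (K n i) * truncated_mean L n\<bar>}"
    for n i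
  have B: "B n i \<in> sets borel" for n i by (simp add: B_def)
  obtain N where N: "\<And>n (J :: 'i set) X. N \<le> n \<Longrightarrow> finite J \<Longrightarrow> card J \<le> n \<Longrightarrow> indep_vars (\<lambda>_. borel) X J \<Longrightarrow>
    (\<forall>j\<in>J. distr M borel (X j) = L) \<Longrightarrow>
    prob {\<omega>\<in>space M. \<eta> * (n * truncated_mean L n) \<le> \<bar>(\<Sum>j\<in>J. X j \<omega>) - card J * truncated_mean L n\<bar>} \<le> e"
    using heavy_tailed_one_weak_law[OF L \<eta> e] unfolding eventually_sequentially by blast
  \<comment> \<open>The condition \<open>Suc N \<le> n\<close> empties the event for small n, so the
    geometric bound holds for every n; where the event is not empty it also gives n > 0.\<close>
  define A where "A n = {\<omega>\<in>space M. Suc N \<le> n \<and>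
    2 * e * n \<le> card {i. i < n \<and> (\<Sum>p\<in>K n i. X p \<omega>) \<in> B n i}}" for n
  have rv [measurable]: "random_variable borel (X p)" if "p \<in> I" for p
    using ind that by (auto simp: indep_vars_def)
  have A_meas: "A n \<in> events" for n
  proof -
    have "(\<lambda>\<omega>. indicat_real (B n i) (\<Sum>p\<in>K n i. X p \<omega>)) \<in> borel_measurable M" if "i < n" for i
    proof -
      have [measurable]: "B n i \<in> sets borel" by (rule B)
      have [measurable]: "(\<lambda>\<omega>. \<Sum>p\<in>K n i. X p \<omega>) \<in> borel_measurable M"
        using K(1)[OF that] by (intro borel_measurable_sum rv) auto
      show ?thesis by measurable
    qed
    then have "(\<lambda>\<omega>. \<Sum>i<n. indicat_real (B n i) (\<Sum>p\<in>K n i. X p \<omega>)) \<in> borel_measurable M"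
      by (intro borel_measurable_sum) auto
    then show ?thesis unfolding A_def card_eq_sum_indicator by simp
  qed
  have A_le: "prob (A n) \<le> exp (- 2 * e\<^sup>2) ^ n" for n
  proof (cases "Suc N \<le> n")
    case True
    have le: "prob {\<omega>\<in>space M. (\<Sum>p\<in>K n i. X p \<omega>) \<in> B n i} \<le> e" if i: "i < n" for i
      unfolding B_def mem_Collect_eq
      by (rule N[OF Suc_leD[OF True] K(2)[OF i] K(3)[OF i] indep_vars_subset[OF ind K(1)[OF i]]])
         (use distr K(1)[OF i] in auto)
    have "0 < n" using True by simp
    from count_block_events[OF ind this K(1) disj B less_imp_le[OF e] le]
    have "prob (A n) \<le> exp (- 2 * e\<^sup>2 * n)"
      unfolding A_def using True by simp
    also have "\<dots> = exp (- 2 * e\<^sup>2) ^ n"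
      by (simp add: exp_of_nat_mult[symmetric] mult.commute)
    finally show ?thesis .
  qed (simp add: A_def)
  have "summable (\<lambda>n. exp (- 2 * e\<^sup>2) ^ n)"
    using e by (intro summable_geometric) simp
  then have "summable (\<lambda>n. prob (A n))"
    by (rule summable_comparison_test'[where N = 0]) (use A_le in simp)
  then have "AE \<omega> in M. \<forall>\<^sub>F n in sequentially. \<omega> \<in> space M - A n"
    by (rule borel_cantelli_AE1[OF A_meas, rotated]) (simp add: emeasure_eq_measure)
  then show ?thesis
  proof eventually_elim
    case (elim \<omega>)
    then show ?case
      using eventually_ge_at_top[of "Suc N"]
      by eventually_elim (auto simp: A_def B_def not_le)
  qed
qed

end

text \<open>Whole row sums are dependent, since rows i and k share an entry. A deviation of size
  \<eta> of a row forces one of size \<eta> / 2 in one of its two parts, whose lengths add up to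
  n.\<close>

lemma AE_few_bad_rows:
  fixes e \<eta> :: real
  assumes L: "heavy_tailed 1 L" and U: "iid_symmetric_table L M U" and \<eta>: "0 < \<eta>" and e: "0 < e"
  shows "AE \<omega> in M. \<forall>\<^sub>F n in sequentially.
    card {i. i < n \<and> \<eta> * (n * truncated_mean L n) \<le> \<bar>(\<Sum>k<n. U i k \<omega>) - n * truncated_mean L n\<bar>} < e * n"
proof -
  interpret prob_space M using U by (simp add: iid_symmetric_table_def)
  define X where "X = (\<lambda>(i, j). U i j)"
  define I where "I = {(i, j). i \<le> (j :: nat)}"
  have ind: "indep_vars (\<lambda>_. borel) X I"
    using U by (simp add: iid_symmetric_table_def X_def I_def)
  have distr: "distr M borel (X p) = L" if "p \<in> I" for p
    using U that by (auto simp: iid_symmetric_table_def X_def I_def)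
  have sym: "U i j = U j i" for i j
    using U by (simp add: iid_symmetric_table_def)
  \<comment> \<open>Both kinds of blocks are written with index pairs in the upper triangle: the
    part of row i left of the diagonal is read off column i by symmetry.\<close>
  define R where "R n i = {i} \<times> {i..<n}" for n i :: nat
  define C where "C n i = {..<i} \<times> {i}" for n i :: nat
  let ?w = "truncated_mean L"
  let ?dev = "\<lambda>K n i \<omega>. \<eta> / 2 * (n * ?w n) \<le> \<bar>(\<Sum>p\<in>K n i. X p \<omega>) - card (K n i) * ?w n\<bar>"
  \<comment> \<open>Each of the two families is allowed e n / 2 deviations.\<close>
  have "AE \<omega> in M. \<forall>\<^sub>F n in sequentially. card {i. i < n \<and> ?dev R n i \<omega>} < 2 * (e / 4) * n"
    by (rule AE_few_block_deviations[OF L ind distr])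
       (use e \<eta> in \<open>auto simp: R_def I_def disjoint_family_on_def\<close>)
  moreover have "AE \<omega> in M. \<forall>\<^sub>F n in sequentially. card {i. i < n \<and> ?dev C n i \<omega>} < 2 * (e / 4) * n"
    by (rule AE_few_block_deviations[OF L ind distr])
       (use e \<eta> in \<open>auto simp: C_def I_def disjoint_family_on_def\<close>)
  ultimately show ?thesis
  proof eventually_elim
    case (elim \<omega>)
    from elim show ?case
    proof eventually_elim
      case (elim n)
      have "{i. i < n \<and> \<eta> * (n * ?w n) \<le> \<bar>(\<Sum>k<n. U i k \<omega>) - n * ?w n\<bar>}
          \<subseteq> {i. i < n \<and> ?dev R n i \<omega>} \<union> {i. i < n \<and> ?dev C n i \<omega>}"
      proof
        fix i assume "i \<in> {i. i < n \<and> \<eta> * (n * ?w n) \<le> \<bar>(\<Sum>k<n. U i k \<omega>) - n * ?w n\<bar>}"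
        then have i: "i < n" and dev: "\<eta> * (n * ?w n) \<le> \<bar>(\<Sum>k<n. U i k \<omega>) - n * ?w n\<bar>" by auto
        have "{..<n} = {..<i} \<union> {i..<n}" using i by auto
        then have "(\<Sum>k<n. U i k \<omega>) = (\<Sum>k<i. U i k \<omega>) + (\<Sum>k\<in>{i..<n}. U i k \<omega>)"
          by (simp add: sum.union_disjoint ivl_disj_int_one)
        moreover have "(\<Sum>p\<in>R n i. X p \<omega>) = (\<Sum>k\<in>{i..<n}. U i k \<omega>)"
          by (simp add: R_def X_def sum.cartesian_product')
        moreover have "(\<Sum>p\<in>C n i. X p \<omega>) = (\<Sum>k<i. U i k \<omega>)"
          by (simp add: C_def X_def sym[of i] sum.cartesian_product')
        moreover have "card (R n i) * ?w n + card (C n i) * ?w n = n * ?w n"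
          using i by (simp add: R_def C_def of_nat_diff algebra_simps)
        ultimately have "?dev R n i \<omega> \<or> ?dev C n i \<omega>"
          using dev by linarith
        then show "i \<in> {i. i < n \<and> ?dev R n i \<omega>} \<union> {i. i < n \<and> ?dev C n i \<omega>}"
          using i by auto
      qed
      then have "card {i. i < n \<and> \<eta> * (n * ?w n) \<le> \<bar>(\<Sum>k<n. U i k \<omega>) - n * ?w n\<bar>}
          \<le> card {i. i < n \<and> ?dev R n i \<omega>} + card {i. i < n \<and> ?dev C n i \<omega>}"
        by (intro order_trans[OF card_mono card_Un_le]) auto
      then show ?case using elim by simp
    qed
  qed
qed

text \<open>A single null set has to serve all \<eta>, so almost sure statements are collected for
  reciprocals of integers only and extended by monotonicity in \<eta>.\<close>

lemma AE_bad_row_fraction_tendsto_0: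
  assumes L: "heavy_tailed 1 L" and U: "iid_symmetric_table L M U"
  shows "AE \<omega> in M. \<forall>\<eta>>0 :: real. (\<lambda>n. card {i. i < n \<and>
    \<eta> * (n * truncated_mean L n) \<le> \<bar>(\<Sum>k<n. U i k \<omega>) - n * truncated_mean L n\<bar>} / n) \<longlonglongrightarrow> 0"
proof -
  have "AE \<omega> in M. \<forall>k l :: nat. \<forall>\<^sub>F n in sequentially.
    card {i. i < n \<and> inverse (Suc k) * (n * truncated_mean L n)
      \<le> \<bar>(\<Sum>j<n. U i j \<omega>) - n * truncated_mean L n\<bar>} < inverse (Suc l) * n"
    unfolding AE_all_countable by (intro allI AE_few_bad_rows[OF L U]) simp_all
  then show ?thesis
  proof eventually_elim
    case (elim \<omega>)
    interpret H: heavy_tailed_one L by unfold_locales fact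
    let ?w = "truncated_mean L"
    let ?bad = "\<lambda>\<eta> n. {i. i < n \<and> \<eta> * (n * ?w n) \<le> \<bar>(\<Sum>j<n. U i j \<omega>) - n * ?w n\<bar>}"
    show ?case
    proof (intro allI impI tendstoI)
      fix \<eta> e :: real assume "0 < \<eta>" "0 < e"
      then obtain k l where kl: "inverse (Suc k) < \<eta>" "inverse (Suc l) < e"
        using reals_Archimedean by metis
      show "\<forall>\<^sub>F n in sequentially. dist (card (?bad \<eta> n) / n) 0 < e"
        using elim[rule_format, of k l] H.truncated_mean_pos eventually_gt_at_top[of 0]
      proof eventually_elim
        case (elim n)
        \<comment> \<open>A smaller \<eta> gives a larger bad set, as n w_n is positive.\<close>
        have "?bad \<eta> n \<subseteq> ?bad (inverse (Suc k)) n"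
          using kl(1) elim mult_right_mono[of "inverse (Suc k)" \<eta> "n * ?w n"]
          by (intro Collect_mono impI conjI) (auto intro: order_trans[rotated])
        then have "card (?bad \<eta> n) \<le> card (?bad (inverse (Suc k)) n)"
          by (intro card_mono) auto
        then have "card (?bad \<eta> n) < inverse (Suc l) * n" using elim by linarith
        also have "\<dots> < e * n" using kl(2) elim by (intro mult_strict_right_mono) auto
        finally show ?case using elim by (simp add: field_simps)
      qed
    qed
  qed
qed

section \<open>Comparison of the spectra\<close>

lemma random_variable_table:
  assumes U: "iid_symmetric_table L M U"
  shows "U i j \<in> borel_measurable M"
proof -
  interpret prob_space M using U by (simp add: iid_symmetric_table_def)
  have "U i j \<in> borel_measurable M" if "i \<le> j" for i j
    using U that by (auto simp: iid_symmetric_table_def indep_vars_def)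
  then show ?thesis
    using U by (cases i j rule: le_cases) (metis iid_symmetric_table_def)+
qed

lemma AE_table:
  assumes U: "iid_symmetric_table L M U" and P: "AE x in L. P x"
  shows "AE \<omega> in M. \<forall>i j. P (U i j \<omega>)"
  unfolding AE_all_countable
proof (intro allI)
  have "AE \<omega> in M. P (U i j \<omega>)" if "i \<le> j" for i j
    using AE_distrD[OF random_variable_table[OF U, of i j]] P U that
    by (auto simp: iid_symmetric_table_def)
  then show "AE \<omega> in M. P (U i j \<omega>)" for i j
    using U by (cases i j rule: le_cases) (metis iid_symmetric_table_def)+
qed

text \<open>The limit hypothesis speaks about tables on one fixed type of sample space; the law of the
  table on the product space carries it over to arbitrary ones.\<close>

lemma iid_symmetric_table_canonical:
  fixes U :: "nat \<Rightarrow> nat \<Rightarrow> 'a \<Rightarrow> real"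
  assumes U: "iid_symmetric_table L M U"
  defines "\<Phi> \<equiv> \<lambda>\<omega> p. U (fst p) (snd p) \<omega>"
  defines "N \<equiv> distr M (PiM UNIV (\<lambda>_. borel)) \<Phi>"
  shows "iid_symmetric_table L N (\<lambda>i j x. x (min i j, max i j))"
    and "\<Phi> \<in> measurable M (PiM UNIV (\<lambda>_. borel))"
proof -
  interpret M: prob_space M using U by (simp add: iid_symmetric_table_def)
  show \<Phi> [measurable]: "\<Phi> \<in> measurable M (PiM UNIV (\<lambda>_. borel))"
    unfolding \<Phi>_def using random_variable_table[OF U] by (intro measurable_PiM_single') auto
  interpret N: prob_space N
    unfolding N_def by (rule M.prob_space_distr) simp
  define I where "I = {(i, j). i \<le> (j :: nat)}"
  define V where "V = (\<lambda>(i, j). U i j)"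
  \<comment> \<open>Reading only upper-triangular coordinates makes the canonical table symmetric at
    every point of the product space, not just on the range of \<open>\<Phi>\<close>.\<close>
  define X :: "nat \<times> nat \<Rightarrow> (nat \<times> nat \<Rightarrow> real) \<Rightarrow> real"
    where "X = (\<lambda>(i, j) x. x (min i j, max i j))"
  have I: "I \<noteq> {}" by (auto simp: I_def)
  have X_meas [measurable]: "X p \<in> borel_measurable (PiM UNIV (\<lambda>_. borel))" for p
    by (cases p) (simp add: X_def)
  have X_N: "N.random_variable borel (X p)" for p
    by (simp add: N_def)
  have X\<Phi>: "X p (\<Phi> \<omega>) = V p \<omega>" if "p \<in> I" for p \<omega>
    using that by (auto simp: X_def \<Phi>_def V_def I_def min_def max_def)
  have V: "M.random_variable borel (V p)" for p
    using random_variable_table[OF U] by (cases p) (simp add: V_def)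
  have distr_X: "distr N borel (X p) = distr M borel (V p)" if "p \<in> I" for p
    unfolding N_def by (subst distr_distr) (auto simp: comp_def X\<Phi>[OF that])
  \<comment> \<open>Independence means that the joint law is the product of the marginals; in this
    form it depends on laws only and carries over.\<close>
  have "M.indep_vars (\<lambda>_. borel) V I"
    using U by (simp add: iid_symmetric_table_def V_def I_def)
  then have "distr M (PiM I (\<lambda>_. borel)) (\<lambda>\<omega>. \<lambda>p\<in>I. V p \<omega>) = PiM I (\<lambda>p. distr M borel (V p))"
    using M.indep_vars_iff_distr_eq_PiM'[OF I V] by simp
  moreover have "distr N (PiM I (\<lambda>_. borel)) (\<lambda>x. \<lambda>p\<in>I. X p x) = distr M (PiM I (\<lambda>_. borel)) (\<lambda>\<omega>. \<lambda>p\<in>I. V p \<omega>)"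
    unfolding N_def
    by (subst distr_distr) (auto simp: comp_def X\<Phi> intro!: measurable_restrict distr_cong)
  moreover have "PiM I (\<lambda>p. distr M borel (V p)) = PiM I (\<lambda>p. distr N borel (X p))"
    by (intro PiM_cong) (auto simp: distr_X)
  ultimately have "N.indep_vars (\<lambda>_. borel) X I"
    using N.indep_vars_iff_distr_eq_PiM'[OF I X_N] by simp
  moreover have "distr N borel (X (i, j)) = L" if "i \<le> j" for i j
    using distr_X[of "(i, j)"] U that by (simp add: I_def V_def iid_symmetric_table_def)
  ultimately show "iid_symmetric_table L N (\<lambda>i j x. x (min i j, max i j))"
    unfolding iid_symmetric_table_def X_def I_def
    using N.prob_space_axioms by (simp add: min.commute max.commute)
qed

text \<open>The weights are almost surely nonnegative, so taking absolute values preserves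
  \<open>L\<close> and the tail balance has limit 1. The limit hypothesis then applies to the
  canonical table and is pulled back along \<open>\<Phi>\<close>.\<close>

lemma symmetric_table_spectral_limit:
  assumes L: "heavy_tailed 1 L" and U: "iid_symmetric_table L M U"
    and \<mu>: "heavy_tailed_spectral_limit 1 \<mu>"
  shows "AE \<omega> in M. weakly_converges
    (\<lambda>n. spectral_measure (inverse (tail_scale L n) \<cdot>\<^sub>m table_mat n (\<lambda>i j. U i j \<omega>))) \<mu>"
proof -
  interpret H: heavy_tailed_one L by unfold_locales fact
  define \<Phi> where "\<Phi> = (\<lambda>\<omega> p. U (fst p) (snd p) \<omega>)"
  define N where "N = distr M (PiM UNIV (\<lambda>_. borel)) \<Phi>"
  let ?X = "\<lambda>i j (x :: nat \<times> nat \<Rightarrow> real). x (min i j, max i j)"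
  have "distr L borel abs = distr L borel (\<lambda>x. x)"
    using H.AE_nonneg by (intro distr_cong_AE) auto
  then have abs: "distr L borel abs = L"
    by (simp add: distr_id2)
  have "measure L {x. t < \<bar>x\<bar>} = measure L {t<..}" if "0 < t" for t
    using H.AE_nonneg by (intro H.finite_measure_eq_AE) auto
  then have "1 = measure L {t<..} / measure L {x. t < \<bar>x\<bar>}" if "0 < t" for t
    using H.tail_pos[of t] that unfolding H.tail_def by simp
  then have "\<forall>\<^sub>F t in at_top. 1 = measure L {t<..} / measure L {x. t < \<bar>x\<bar>}"
    using eventually_gt_at_top[of 0] by (rule eventually_mono[rotated])
  then have "((\<lambda>t. measure L {t<..} / measure L {x. t < \<bar>x\<bar>}) \<longlongrightarrow> 1) at_top"
    by (rule Lim_transform_eventually[OF tendsto_const])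
  moreover have "iid_symmetric_table L N ?X"
    unfolding N_def \<Phi>_def by (rule iid_symmetric_table_canonical[OF U])
  ultimately have "iid_symmetric_table L N ?X \<and> heavy_tailed 1 (distr L borel abs) \<and>
      (\<exists>\<theta>. ((\<lambda>t. measure L {t<..} / measure L {x. t < \<bar>x\<bar>}) \<longlongrightarrow> \<theta>) at_top)"
    using L unfolding abs by blast
  moreover have "iid_symmetric_table \<nu> N X \<and> heavy_tailed 1 (distr \<nu> borel abs) \<and>
      (\<exists>\<theta>. ((\<lambda>t. measure \<nu> {t<..} / measure \<nu> {x. t < \<bar>x\<bar>}) \<longlongrightarrow> \<theta>) at_top) \<longrightarrow>
      (AE x in N. weakly_converges (\<lambda>n. spectral_measure
        (inverse (tail_scale (distr \<nu> borel abs) n) \<cdot>\<^sub>m table_mat n (\<lambda>i j. X i j x))) \<mu>)"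
    for \<nu> :: "real measure" and N :: "(nat \<times> nat \<Rightarrow> real) measure" and X
    using \<mu> unfolding heavy_tailed_spectral_limit_def by blast
  ultimately have "AE x in N. weakly_converges (\<lambda>n. spectral_measure
      (inverse (tail_scale (distr L borel abs) n) \<cdot>\<^sub>m table_mat n (\<lambda>i j. ?X i j x))) \<mu>"
    by blast
  then have "AE x in N. weakly_converges
      (\<lambda>n. spectral_measure (inverse (tail_scale L n) \<cdot>\<^sub>m table_mat n (\<lambda>i j. ?X i j x))) \<mu>"
    unfolding abs .
  from AE_distrD[OF _ this[unfolded N_def]]
  have "AE \<omega> in M. weakly_converges
      (\<lambda>n. spectral_measure (inverse (tail_scale L n) \<cdot>\<^sub>m table_mat n (\<lambda>i j. ?X i j (\<Phi> \<omega>)))) \<mu>"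
    using iid_symmetric_table_canonical(2)[OF U] by (simp add: \<Phi>_def)
  moreover have "?X i j (\<Phi> \<omega>) = U i j \<omega>" for i j \<omega>
    using U by (auto simp: \<Phi>_def iid_symmetric_table_def min_def max_def)
  ultimately show ?thesis by simp
qed

text \<open>A row with zero sum is the zero row, and the corresponding row of the Markov matrix is that of
  the identity; both are absorbed into the exceptional rows.\<close>

lemma markov_mat_spectral_sandwich:
  fixes u :: "nat \<Rightarrow> nat \<Rightarrow> real"
  assumes n: "0 < n" and a: "0 < a" and w: "0 < w" and \<eta>: "0 < \<eta>" "\<eta> < 1"
    and nonneg: "\<And>i j. 0 \<le> u i j" and sym: "\<And>i j. u j i = u i j"
  defines "b \<equiv> card {i. i < n \<and> \<eta> * (n * w) \<le> \<bar>(\<Sum>k<n. u i k) - n * w\<bar>} / n"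
    and "K \<equiv> spectral_measure ((n * inverse a * w) \<cdot>\<^sub>m markov_mat n u)"
    and "A \<equiv> spectral_measure (inverse a \<cdot>\<^sub>m table_mat n u)"
  shows "measure K {t<..} \<le> measure A {t - \<eta> * \<bar>t\<bar><..} + b"
    and "measure A {t + \<eta> * \<bar>t\<bar><..} \<le> measure K {t<..} + b"
proof -
  define \<rho> where "\<rho> i = (\<Sum>k<n. u i k)" for i
  define bad where "bad = {i. i < n \<and> \<eta> * (n * w) \<le> \<bar>\<rho> i - n * w\<bar>}"
  \<comment> \<open>On a zero row the weight 1 keeps the pencil definite, and the diagonal entry of
    \<open>B\<close> reproduces the scaled identity row of the Markov matrix. \<open>B\<close> stays
    symmetric because by nonnegativity and symmetry a zero sum kills both row and column.\<close>
  define d where "d i = (if \<rho> i = 0 then 1 else \<rho> i / (n * w))" for i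
  define B where "B = mat n n (\<lambda>(i, j). if \<rho> i = 0 \<or> \<rho> j = 0
    then (if i = j then n * inverse a * w else 0) else u i j / a)"
  define C where "C = mat n n (\<lambda>(i, j). u i j / a)"
  have nw: "0 < n * w" using n w by simp
  have \<rho>_nonneg: "0 \<le> \<rho> i" for i
    unfolding \<rho>_def using nonneg by (intro sum_nonneg) auto
  have d_pos: "0 < d i" for i
    using \<rho>_nonneg[of i] nw by (auto simp: d_def)
  have u0: "u i j = 0" if "\<rho> i = 0" "j < n" for i j
    using that nonneg unfolding \<rho>_def by (subst (asm) sum_nonneg_eq_0_iff) auto
  have u0': "u i j = 0" if "\<rho> j = 0" "i < n" for i j
    using u0[OF that] sym by simp
  have K_eq: "(n * inverse a * w) \<cdot>\<^sub>m markov_mat n u = mat n n (\<lambda>(i, j). index_mat B (i, j) / d i)"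
    using nw a by (intro eq_matI)
      (auto simp: markov_mat_def B_def d_def Let_def u0 u0' \<rho>_def[symmetric] field_simps)
  have A_eq: "inverse a \<cdot>\<^sub>m table_mat n u = mat n n (\<lambda>(i, j). index_mat C (i, j) / 1)"
    by (intro eq_matI) (auto simp: table_mat_def C_def field_simps)
  have B: "B \<in> carrier_mat n n" "transpose_mat B = B" and C: "C \<in> carrier_mat n n" "transpose_mat C = C"
    by (auto intro!: eq_matI simp: B_def C_def sym)
  have bad: "bad \<subseteq> {..<n}" by (auto simp: bad_def)
  have b_eq: "b = card bad / n" by (simp add: b_def bad_def \<rho>_def)
  \<comment> \<open>As \<eta> < 1, a row within \<eta> n w of its centering has nonzero sum; hence
    \<open>B\<close> and \<open>C\<close> agree off \<open>bad\<close>.\<close>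
  have good: "\<rho> i \<noteq> 0 \<and> \<bar>d i - 1\<bar> \<le> \<eta>" if "i < n" "i \<notin> bad" for i
  proof -
    have *: "\<bar>\<rho> i - n * w\<bar> < \<eta> * (n * w)" using that by (auto simp: bad_def)
    have "\<eta> * (n * w) < 1 * (n * w)" using \<eta> nw by (intro mult_strict_right_mono)
    then have "\<rho> i \<noteq> 0" using * nw by auto
    moreover have "\<bar>\<rho> i / (n * w) - 1\<bar> = \<bar>\<rho> i - n * w\<bar> / (n * w)"
      using nw by (metis abs_divide abs_of_pos diff_divide_distrib divide_self less_irrefl)
    ultimately show ?thesis
      using * nw by (auto simp: d_def pos_divide_le_eq)
  qed
  \<comment> \<open>Both one-sided consequences are used, one for each direction of the comparison
    with the pencil \<open>C\<close> whose weights are all 1.\<close>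
  have td: "\<bar>t * d i - t\<bar> \<le> \<eta> * \<bar>t\<bar>" if "i < n" "i \<notin> bad" for i
    using good[OF that] mult_right_mono[of "\<bar>d i - 1\<bar>" \<eta> "\<bar>t\<bar>"]
    by (simp add: abs_mult[symmetric] algebra_simps)
  show "measure K {t<..} \<le> measure A {t - \<eta> * \<bar>t\<bar><..} + b"
    unfolding K_def A_def K_eq A_eq b_eq
    by (rule spectral_measure_pencil_tail_le[OF n B d_pos C _ bad])
       (use good td in \<open>fastforce simp: B_def C_def\<close>)+
  show "measure A {t + \<eta> * \<bar>t\<bar><..} \<le> measure K {t<..} + b"
    unfolding K_def A_def K_eq A_eq b_eq
    by (rule spectral_measure_pencil_tail_le[OF n C _ B d_pos bad])
       (use good td in \<open>fastforce simp: B_def C_def\<close>)+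
qed

theorem theorem1p5:
  fixes L \<mu>\<^sub>1 :: "real measure" and M :: "'a measure" and U :: "nat \<Rightarrow> nat \<Rightarrow> 'a \<Rightarrow> real"
  assumes "heavy_tailed 1 L"
    and "\<exists>\<epsilon>::real. 0 < \<epsilon> \<and> \<epsilon> < 1 / 2 \<and>
           0 < liminf (\<lambda>n. ereal (truncated_mean L (nat \<lfloor>real n powr \<epsilon>\<rfloor>) / truncated_mean L n))"
    and "iid_symmetric_table L M U"
    and "heavy_tailed_spectral_limit 1 \<mu>\<^sub>1"
  shows "AE \<omega> in M. weakly_converges
           (\<lambda>n. spectral_measure (kappa L n \<cdot>\<^sub>m markov_mat n (\<lambda>i j. U i j \<omega>))) \<mu>\<^sub>1"
proof -
  note L = assms(1) and U = assms(3) and \<mu> = assms(4)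
  interpret H: heavy_tailed_one L by unfold_locales fact
  have \<mu>_dist: "real_distribution \<mu>\<^sub>1"
    using \<mu> unfolding heavy_tailed_spectral_limit_def real_distribution_def real_distribution_axioms_def
    by auto
  have sym: "U j i = U i j" for i j
    using U by (simp add: iid_symmetric_table_def)
  have "AE \<omega> in M. \<forall>i j. 0 \<le> U i j \<omega>"
    by (rule AE_table[OF U H.AE_nonneg])
  with symmetric_table_spectral_limit[OF L U \<mu>] AE_bad_row_fraction_tendsto_0[OF L U]
  show ?thesis
  proof eventually_elim
    case (elim \<omega>)
    have nonneg: "0 \<le> U i j \<omega>" for i j using elim(3) by blast
    let ?u = "\<lambda>i j. U i j \<omega>"
    let ?K = "\<lambda>n. spectral_measure (kappa L n \<cdot>\<^sub>m markov_mat n ?u)"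
    let ?A = "\<lambda>n. spectral_measure (inverse (tail_scale L n) \<cdot>\<^sub>m table_mat n ?u)"
    \<comment> \<open>From here on the outcome is fixed and the argument is deterministic; it starts
      at size 1, where spectral measures are probabilities.\<close>
    have "weakly_converges (\<lambda>n. ?K (Suc n)) \<mu>\<^sub>1"
    proof (rule weakly_converges_sandwich[where N' = "\<lambda>n. ?A (Suc n)"])
      show "real_distribution (?K (Suc n))" "real_distribution (?A (Suc n))" for n
        by (intro real_distribution_spectral_measure; simp add: markov_mat_def table_mat_def)+
      show "real_distribution \<mu>\<^sub>1" by fact
      show "weakly_converges (\<lambda>n. ?A (Suc n)) \<mu>\<^sub>1"
        using elim(1) weakly_converges_Suc_iff[of ?A] by blast
      fix \<eta> :: real assume \<eta>: "0 < \<eta>" "\<eta> < 1"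
      define b where "b n = card {i. i < n \<and> \<eta> * (n * truncated_mean L n)
        \<le> \<bar>(\<Sum>k<n. ?u i k) - n * truncated_mean L n\<bar>} / n" for n
      have "b \<longlonglongrightarrow> 0"
        using elim(2) \<eta>(1) unfolding b_def by blast
      then have "(\<lambda>n. b (Suc n)) \<longlonglongrightarrow> 0"
        by (rule LIMSEQ_Suc)
      moreover have "\<forall>\<^sub>F n in sequentially. \<forall>t.
          measure (?K n) {t<..} \<le> measure (?A n) {t - \<eta> * \<bar>t\<bar><..} + b n \<and>
          measure (?A n) {t + \<eta> * \<bar>t\<bar><..} \<le> measure (?K n) {t<..} + b n"
        using H.truncated_mean_pos eventually_gt_at_top[of 0]
          H.tail_scale_at_top[unfolded filterlim_at_top_dense, rule_format, of 0]
      proof eventually_elim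
        case (elim n)
        show ?case
          unfolding kappa_def b_def
          by (intro allI conjI markov_mat_spectral_sandwich)
             (use elim \<eta> nonneg sym in auto)
      qed
      then have "\<forall>\<^sub>F n in sequentially. \<forall>t.
          measure (?K (Suc n)) {t<..} \<le> measure (?A (Suc n)) {t - \<eta> * \<bar>t\<bar><..} + b (Suc n) \<and>
          measure (?A (Suc n)) {t + \<eta> * \<bar>t\<bar><..} \<le> measure (?K (Suc n)) {t<..} + b (Suc n)"
        by (rule eventually_compose_filterlim[OF _ filterlim_Suc])
      ultimately show "\<exists>b. b \<longlonglongrightarrow> 0 \<and> (\<forall>\<^sub>F n in sequentially. \<forall>t.
          measure (?K (Suc n)) {t<..} \<le> measure (?A (Suc n)) {t - \<eta> * \<bar>t\<bar><..} + b n \<and>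
          measure (?A (Suc n)) {t + \<eta> * \<bar>t\<bar><..} \<le> measure (?K (Suc n)) {t<..} + b n)"
        by (intro exI[of _ "\<lambda>n. b (Suc n)"]) simp
    qed
    then show ?case
      using weakly_converges_Suc_iff[of ?K] by blast
  qed
qed

end
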